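(* Let $a_1,a_2,a_3,b_1,b_2,b_3$ be constants. When $f,g\in L_2(\mathbb{R})$ and $\lim_{|x|\to\infty}|f(x)x^{2+\epsilon}|=0$, $\epsilon>0$, the equation $$(a_1x+b_1)f''(x)+(a_2x+b_2)f'(x)+(a_3x+b_3)f(x)=g(x)$$ can be reduced to $$(-ia_1\gamma^2+a_2\gamma+ia_3)\frac{d\widehat f(\gamma)}{d\gamma}+(-b_1\gamma^2-2ia_1\gamma+ib_2\gamma+a_2+b_3)\widehat f(\gamma)=\widehat g(\gamma),$$ which is solvable.
   Context: The Fourier transform of a function $f\in L_2(\mathbb{R})$ is $\widehat f(\gamma)=\int_{-\infty}^{\infty}f(t)e^{-it\gamma}\,dt$, with inverse $f(x)=\frac{1}{2\pi}\int_{-\infty}^{\infty}\widehat f(\gamma)e^{i\gamma x}\,d\gamma$.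
   Formalization: The reduced equation is proved with -a_2γ and -a_2 in place of the printed +a_2γ and +a_2, since the transform of x f' is -γ f̂' - f̂; the printed signs fail for f = e^{-x²/2}, a_2 = 1, other constants 0. *)

theory Defs
  imports "HOL-Analysis.Analysis"
begin

definition L2 :: "(real \<Rightarrow> complex) \<Rightarrow> bool" where
  "L2 f \<longleftrightarrow> f \<in> borel_measurable lborel \<and> integrable lborel (\<lambda>x. (cmod (f x))\<^sup>2)"

(* For f in L2, the integral of f(t) exp(-i t w) over the real line need not converge absolutely;
   it is then the limit, in the L2 norm, of the integrals over [-R,R].  The error is measured by
   the nonnegative integral because the Bochner integral of a non-integrable function is 0. *)
definition is_L2_fourier :: "(real \<Rightarrow> complex) \<Rightarrow> (real \<Rightarrow> complex) \<Rightarrow> bool" where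
  "is_L2_fourier f F \<longleftrightarrow> L2 F \<and>
     ((\<lambda>R. \<integral>\<^sup>+ w. ennreal ((cmod (F w -
          (LINT t:{-R..R}|lborel. f t * exp (- \<i> * of_real t * of_real w))))\<^sup>2) \<partial>lborel)
        \<longlongrightarrow> 0) at_top"

(* The two branches agree almost everywhere when f is both integrable and in L2.  For integrable f
   the integral formula fixes a value at every point, so that the transform can be
   differentiated; otherwise it is determined only almost everywhere. *)
definition fourier :: "(real \<Rightarrow> complex) \<Rightarrow> real \<Rightarrow> complex" where
  "fourier f =
     (if integrable lborel f
      then (\<lambda>w. LINT t|lborel. f t * exp (- \<i> * of_real t * of_real w))
      else (SOME F. is_L2_fourier f F))"

(* The right-hand side h is typically the transform of an L2 function and so only given almost
   everywhere; hence the equation A y' + B y = h is imposed almost everywhere on J, while y is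
   differentiable at every point of J. *)
definition solves_linear_ode_on ::
  "real set \<Rightarrow> (real \<Rightarrow> complex) \<Rightarrow> (real \<Rightarrow> complex) \<Rightarrow> (real \<Rightarrow> complex) \<Rightarrow> (real \<Rightarrow> complex) \<Rightarrow> bool" where
  "solves_linear_ode_on J A B h y \<longleftrightarrow>
     (\<forall>w\<in>J. y differentiable (at w)) \<and>
     (AE w in lborel. w \<in> J \<longrightarrow> A w * vector_derivative y (at w) + B w * y w = h w)"

(* The integrals are oriented, so w < w0 is allowed. *)
definition integrating_factor_solution ::
  "(real \<Rightarrow> complex) \<Rightarrow> (real \<Rightarrow> complex) \<Rightarrow> (real \<Rightarrow> complex) \<Rightarrow> real \<Rightarrow> complex \<Rightarrow> real \<Rightarrow> complex" where
  "integrating_factor_solution A B h w0 c w =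
     (let P = (\<lambda>s. LBINT r=ereal w0..ereal s. B r / A r)
      in exp (- P w) * (c + (LBINT s=ereal w0..ereal w. exp (P s) * h s / A s)))"

(* Solvability of A y' + B y = h: a solution exists on the whole line; on every open interval free
   of zeros of A, each initial value problem has exactly one solution, namely the one given by the
   integrating factor; where A vanishes the equation is algebraic and is solved by division
   (this matters when A is identically 0). *)
definition solvable_linear_ode ::
  "(real \<Rightarrow> complex) \<Rightarrow> (real \<Rightarrow> complex) \<Rightarrow> (real \<Rightarrow> complex) \<Rightarrow> bool" where
  "solvable_linear_ode A B h \<longleftrightarrow>
     (\<exists>y. solves_linear_ode_on UNIV A B h y) \<and>
     (\<forall>J w0 c. open J \<and> is_interval J \<and> (\<forall>w\<in>J. A w \<noteq> 0) \<and> w0 \<in> J \<longrightarrow>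
        solves_linear_ode_on J A B h (integrating_factor_solution A B h w0 c) \<and>
        integrating_factor_solution A B h w0 c w0 = c \<and>
        (\<forall>z. solves_linear_ode_on J A B h z \<and> z w0 = c \<longrightarrow>
             (\<forall>w\<in>J. z w = integrating_factor_solution A B h w0 c w))) \<and>
     (\<forall>z. solves_linear_ode_on UNIV A B h z \<longrightarrow>
        (AE w in lborel. A w = 0 \<and> B w \<noteq> 0 \<longrightarrow> z w = h w / B w))"

end

theory Submission
  imports Defs "HOL-Probability.Probability"
begin

text \<open>Lagrange's identity for the differential operator, tested against the exponential and
  integrated over \<open>[-R, R]\<close>, expresses the truncated transform of \<open>g\<close> through boundary terms and
  the truncated transforms of \<open>f t\<close> and \<open>t f t\<close>. The boundary terms vanish in the limit even though
  nothing is assumed about \<open>f'\<close>: averaging the equation over a unit interval shows that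
  \<open>(a1 x + b1) f' x\<close> tends to 0. Hence the truncated transforms of \<open>g\<close> converge pointwise to the
  left-hand side of the transformed equation, and by the Plancherel inequality and Fatou's lemma they
  do so in \<open>L\<^sub>2\<close> as well. The transformed equation is linear of first order with
  polynomial coefficients and a right-hand side that is almost everywhere equal to a continuous
  function, so the integrating factor solves it.\<close>

subsection \<open>The Plancherel inequality\<close>

text \<open>\<open>fourier\<close> is the integral formula on integrable functions and an
  arbitrarily chosen L2 limit otherwise. The decay exponent exceeds 2, so \<open>f t\<close> and
  \<open>t * f t\<close> are integrable and \<open>fourier f\<close> is differentiable at every
  point. But \<open>g\<close> may fail to be integrable, and then \<open>fourier g\<close> is an
  arbitrary member of its almost-everywhere class. Hence a continuous representative
  \<open>H\<close> accompanies it, and the integrating factor formula, which contains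
  \<open>fourier g\<close>, is compared with the one for \<open>H\<close>.

  The second derivative of \<open>f\<close> is only known to exist: it may be discontinuous, and
  where \<open>a1 x + b1\<close> vanishes the equation does not control it. Integration by parts
  therefore uses the gauge integral, whose fundamental theorem holds for every derivative; Lebesgue
  integrals enter afterwards.

  An integrating factor cannot cross a zero of the leading coefficient. The solution on the whole
  line is \<open>fourier f\<close> itself.\<close>

definition fourier_kernel :: "real \<Rightarrow> real \<Rightarrow> complex" where
  "fourier_kernel w t = exp (- \<i> * of_real t * of_real w)"

definition fourier_integral :: "(real \<Rightarrow> complex) \<Rightarrow> real \<Rightarrow> complex" where
  "fourier_integral h w = (LINT t|lborel. h t * fourier_kernel w t)"

lemma norm_fourier_kernel [simp]: "norm (fourier_kernel w t) = 1"
  by (simp add: fourier_kernel_def norm_exp_eq_Re)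

lemma borel_measurable_fourier_kernel [measurable]:
  assumes [measurable]: "f \<in> borel_measurable M" "g \<in> borel_measurable M"
  shows "(\<lambda>x. fourier_kernel (f x) (g x)) \<in> borel_measurable M"
  unfolding fourier_kernel_def by measurable

lemma borel_measurable_cnj [measurable]:
  "f \<in> borel_measurable M \<Longrightarrow> (\<lambda>x. cnj (f x)) \<in> borel_measurable M"
  by (rule borel_measurable_continuous_on[OF continuous_on_cnj[OF continuous_on_id]])

lemma integrable_mult_fourier_kernel:
  assumes "integrable lborel h"
  shows "integrable lborel (\<lambda>t. h t * fourier_kernel w t)"
proof (rule Bochner_Integration.integrable_bound[OF assms])
  have [measurable]: "h \<in> borel_measurable lborel" using assms by auto
  show "(\<lambda>t. h t * fourier_kernel w t) \<in> borel_measurable lborel" by measurable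
qed (simp add: norm_mult)

lemma fourier_kernel_diff:
  "fourier_kernel w s * cnj (fourier_kernel w t) = fourier_kernel w (s - t)"
  by (simp add: fourier_kernel_def exp_cnj exp_diff exp_minus field_simps)

text \<open>This is the characteristic function of the standard normal law at
  \<open>- x / \<delta>\<close>, after the substitution of \<open>\<delta> * w\<close> for the
  variable. The normalisation of the density produces the constant \<open>2 * pi\<close> of the
  Plancherel inequality.\<close>

lemma fourier_integral_gaussian:
  assumes "\<delta> > 0"
  shows "(LINT w|lborel. of_real (exp (- (\<delta> * w)\<^sup>2 / 2)) * fourier_kernel w x)
       = of_real (2 * pi * normal_density 0 \<delta> x)"
proof -
  have "(LINT w|lborel. std_normal_density w *\<^sub>R iexp (t * w)) = of_real (exp (- t\<^sup>2 / 2))" for t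
    using fun_cong[OF char_std_normal_distribution, of t]
    unfolding char_def by (subst (asm) integral_density) (auto simp: normal_density_nonneg)
  from this[of "- x / \<delta>"]
  have "\<delta> *\<^sub>R (LINT w|lborel. std_normal_density (\<delta> * w) *\<^sub>R iexp (- x / \<delta> * (\<delta> * w)))
      = of_real (exp (- (x / \<delta>)\<^sup>2 / 2))"
    using assms by (subst (asm) lborel_integral_real_affine[where c = \<delta> and t = 0])
      (auto simp: power_divide)
  moreover have "std_normal_density (\<delta> * w) *\<^sub>R iexp (- x / \<delta> * (\<delta> * w))
      = of_real (1 / sqrt (2 * pi)) * (of_real (exp (- (\<delta> * w)\<^sup>2 / 2)) * fourier_kernel w x)" for w
    using assms by (simp add: std_normal_density_def scaleR_conv_of_real fourier_kernel_def algebra_simps)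
  ultimately have "of_real \<delta> * of_real (1 / sqrt (2 * pi)) *
      (LINT w|lborel. of_real (exp (- (\<delta> * w)\<^sup>2 / 2)) * fourier_kernel w x)
      = complex_of_real (exp (- (x / \<delta>)\<^sup>2 / 2))"
    by (simp add: scaleR_conv_of_real)
  then have "(LINT w|lborel. of_real (exp (- (\<delta> * w)\<^sup>2 / 2)) * fourier_kernel w x)
      = of_real (sqrt (2 * pi) / \<delta> * exp (- (x / \<delta>)\<^sup>2 / 2))"
    using assms by (simp add: field_simps)
  also have "sqrt (2 * pi) / \<delta> * exp (- (x / \<delta>)\<^sup>2 / 2) = 2 * pi * normal_density 0 \<delta> x"
    using assms by (simp add: normal_density_def real_sqrt_mult power_divide field_simps)
  finally show ?thesis .
qed

lemma integrable_gaussian: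
  fixes \<delta> :: real
  assumes "\<delta> > 0"
  shows "integrable lborel (\<lambda>w. exp (- (\<delta> * w)\<^sup>2 / 2))"
proof -
  have "integrable lborel (\<lambda>w. sqrt (2 * pi) * std_normal_density (0 + \<delta> * w))"
    using assms by (intro integrable_mult_right lborel_integrable_real_affine) auto
  then show ?thesis by (simp add: std_normal_density_def)
qed

lemma nn_integral_normal_density:
  "\<sigma> > 0 \<Longrightarrow> (\<integral>\<^sup>+ x. ennreal (normal_density \<mu> \<sigma> x) \<partial>lborel) = 1"
  by (subst nn_integral_eq_integral) (auto simp: one_ennreal_def)

lemma lborel_pair_mult:
  fixes f :: "'a::euclidean_space \<Rightarrow> complex" and g :: "'b::euclidean_space \<Rightarrow> complex"
  assumes f: "integrable lborel f" and g: "integrable lborel g"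
  shows "integrable (lborel \<Otimes>\<^sub>M lborel) (\<lambda>(x, y). f x * g y)"
    and "(LINT p|(lborel \<Otimes>\<^sub>M lborel). f (fst p) * g (snd p)) = integral\<^sup>L lborel f * integral\<^sup>L lborel g"
proof -
  have [measurable]: "f \<in> borel_measurable borel" "g \<in> borel_measurable borel"
    using f g by (auto dest: borel_measurable_integrable)
  show I: "integrable (lborel \<Otimes>\<^sub>M lborel) (\<lambda>(x, y). f x * g y)"
    using f g by (intro lborel_pair.Fubini_integrable) (auto simp: norm_mult)
  then show "(LINT p|(lborel \<Otimes>\<^sub>M lborel). f (fst p) * g (snd p)) = integral\<^sup>L lborel f * integral\<^sup>L lborel g"
    using lborel_pair.integral_fst'[OF I] g by (simp add: case_prod_unfold)
qed

text \<open>Writing the squared modulus of the transform of \<open>h\<close> as a double integral and integrating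
  the Gaussian weight first turns the weighted norm into \<open>2\<pi>\<close> times a quadratic form in \<open>h\<close> whose kernel has
  mass 1 in each variable.\<close>

lemma fourier_integral_gaussian_norm:
  assumes h: "integrable lborel h" and h2: "integrable lborel (\<lambda>x. (cmod (h x))\<^sup>2)" and "\<delta> > 0"
  shows "(\<integral>\<^sup>+ w. ennreal (exp (- (\<delta> * w)\<^sup>2 / 2) * (cmod (fourier_integral h w))\<^sup>2) \<partial>lborel)
       \<le> ennreal (2 * pi * (LINT x|lborel. (cmod (h x))\<^sup>2))"
proof -
  have hm[measurable]: "h \<in> borel_measurable borel" using h by (auto dest: borel_measurable_integrable)
  define k :: "real \<Rightarrow> complex" where "k = (\<lambda>w. of_real (exp (- (\<delta> * w)\<^sup>2 / 2)))"
  define F :: "real \<Rightarrow> real \<times> real \<Rightarrow> complex" where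
    "F = (\<lambda>w p. k w * (h (fst p) * cnj (h (snd p))) * fourier_kernel w (fst p - snd p))"
  have [measurable]: "k \<in> borel_measurable borel" unfolding k_def by measurable
  have k: "integrable lborel k"
    unfolding k_def using integrable_gaussian[OF \<open>\<delta> > 0\<close>] by (rule integrable_of_real)
  have hh: "integrable lborel (\<lambda>p. h (fst p) * cnj (h (snd p)))"
    using lborel_pair_mult(1)[of h "\<lambda>t. cnj (h t)"] h by (simp add: case_prod_unfold lborel_prod)
  \<comment> \<open>The Gaussian \<open>k\<close> makes \<open>F\<close> absolutely integrable in
    all three variables, because the kernel has modulus 1. This is what licenses the exchange of
    integrals below.\<close>
  have F: "integrable (lborel \<Otimes>\<^sub>M lborel) (case_prod F)"
  proof (rule Bochner_Integration.integrable_bound[OF lborel_pair_mult(1)[OF k hh]])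
    have "case_prod F \<in> borel_measurable (borel \<Otimes>\<^sub>M (borel \<Otimes>\<^sub>M borel))"
      unfolding F_def by measurable
    then show "case_prod F \<in> borel_measurable (lborel \<Otimes>\<^sub>M lborel)"
      by (simp only: borel_prod lborel_prod measurable_lborel1 measurable_lborel2)
  qed (auto simp: F_def norm_mult)
  have Fw: "(LINT p|lborel. F w p) = of_real (exp (- (\<delta> * w)\<^sup>2 / 2) * (cmod (fourier_integral h w))\<^sup>2)" for w
  proof -
    have "(LINT p|lborel. F w p)
        = k w * (LINT p|(lborel \<Otimes>\<^sub>M lborel). (h (fst p) * fourier_kernel w (fst p)) * cnj (h (snd p) * fourier_kernel w (snd p)))"
      by (simp add: F_def fourier_kernel_diff[symmetric] mult_ac lborel_prod)
    also have "\<dots> = k w * (fourier_integral h w * cnj (fourier_integral h w))"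
      using integrable_mult_fourier_kernel[OF h, of w]
      by (subst lborel_pair_mult(2)) (auto simp: fourier_integral_def simp del: complex_cnj_mult)
    finally show ?thesis by (simp only: k_def of_real_mult complex_norm_square)
  qed
  have Fp: "(LINT w|lborel. F w p)
      = of_real (2 * pi * normal_density 0 \<delta> (fst p - snd p)) * (h (fst p) * cnj (h (snd p)))" for p
  proof -
    have "F w p = (h (fst p) * cnj (h (snd p))) * (k w * fourier_kernel w (fst p - snd p))" for w
      by (simp add: F_def mult_ac)
    then show ?thesis using fourier_integral_gaussian[OF \<open>\<delta> > 0\<close>] by (simp add: k_def mult_ac)
  qed
  let ?I = "\<integral>w. exp (- (\<delta> * w)\<^sup>2 / 2) * (cmod (fourier_integral h w))\<^sup>2 \<partial>lborel"
  have iw: "integrable lborel (\<lambda>w. exp (- (\<delta> * w)\<^sup>2 / 2) * (cmod (fourier_integral h w))\<^sup>2)"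
    using lborel_pair.integrable_fst[OF F] unfolding Fw complex_of_real_integrable_eq .
  have ip: "integrable lborel (\<lambda>p. LINT w|lborel. F w p)"
    using lborel_pair.integrable_snd[OF F] .
  have "complex_of_real ?I = (LINT w|lborel. LINT p|lborel. F w p)"
    by (simp only: Fw integral_complex_of_real)
  also have "\<dots> = (LINT p|lborel. LINT w|lborel. F w p)"
    using lborel_pair.Fubini_integral[OF F] by simp
  finally have eq: "complex_of_real ?I = (LINT p|lborel. LINT w|lborel. F w p)" .
  let ?N = "\<lambda>s t. normal_density t \<delta> s"
  have N: "normal_density 0 \<delta> (s - t) = ?N s t" "?N s t = ?N t s" for s t
    by (simp_all add: normal_density_def power2_commute)
  have "ennreal ?I \<le> ennreal (cmod (of_real ?I))" by (simp add: ennreal_leI)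
  also have "\<dots> \<le> (\<integral>\<^sup>+ p. ennreal (cmod (LINT w|lborel. F w p)) \<partial>lborel)"
    unfolding eq by (rule integral_norm_bound_ennreal[OF ip])
  \<comment> \<open>Schur test: \<open>2 * a * b \<le> a\<^sup>2 + b\<^sup>2\<close> splits the
    quadratic form into two halves, one for each variable. In each half the normal density
    integrates to 1 over the other variable and leaves \<open>pi\<close> times the squared norm of
    \<open>h\<close>.\<close>
  also have "\<dots> \<le> (\<integral>\<^sup>+ p. ennreal (pi * (cmod (h (fst p)))\<^sup>2) * ennreal (?N (fst p) (snd p))
                         + ennreal (pi * (cmod (h (snd p)))\<^sup>2) * ennreal (?N (fst p) (snd p)) \<partial>lborel)"
  proof (rule nn_integral_mono)
    fix p :: "real \<times> real"
    let ?n = "?N (fst p) (snd p)"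
    have "2 * (cmod (h (fst p)) * cmod (h (snd p))) \<le> (cmod (h (fst p)))\<^sup>2 + (cmod (h (snd p)))\<^sup>2"
      using sum_squares_bound[of "cmod (h (fst p))" "cmod (h (snd p))"] by simp
    then have "pi * ?n * (2 * (cmod (h (fst p)) * cmod (h (snd p)))) \<le> pi * ?n * ((cmod (h (fst p)))\<^sup>2 + (cmod (h (snd p)))\<^sup>2)"
      by (intro mult_left_mono) auto
    then have "cmod (LINT w|lborel. F w p) \<le> pi * (cmod (h (fst p)))\<^sup>2 * ?n + pi * (cmod (h (snd p)))\<^sup>2 * ?n"
      by (simp add: Fp norm_mult N abs_mult algebra_simps)
    then show "ennreal (cmod (LINT w|lborel. F w p)) \<le> ennreal (pi * (cmod (h (fst p)))\<^sup>2) * ennreal ?n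
                         + ennreal (pi * (cmod (h (snd p)))\<^sup>2) * ennreal ?n"
      by (simp add: ennreal_mult[symmetric] ennreal_plus[symmetric] ennreal_leI del: ennreal_plus)
  qed
  also have "\<dots> = (\<integral>\<^sup>+ p. ennreal (pi * (cmod (h (fst p)))\<^sup>2) * ennreal (?N (fst p) (snd p)) \<partial>lborel)
       + (\<integral>\<^sup>+ p. ennreal (pi * (cmod (h (snd p)))\<^sup>2) * ennreal (?N (fst p) (snd p)) \<partial>lborel)"
    unfolding normal_density_def by (rule nn_integral_add) (simp_all add: borel_prod[symmetric])
  also have "(\<integral>\<^sup>+ p. ennreal (pi * (cmod (h (fst p)))\<^sup>2) * ennreal (?N (fst p) (snd p)) \<partial>lborel)
      = (\<integral>\<^sup>+ s. \<integral>\<^sup>+ t. ennreal (pi * (cmod (h s))\<^sup>2) * ennreal (?N s t) \<partial>lborel \<partial>lborel)"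
    unfolding lborel_prod[symmetric] normal_density_def
    by (subst lborel.nn_integral_fst[symmetric]) simp_all
  also have "\<dots> = (\<integral>\<^sup>+ s. ennreal (pi * (cmod (h s))\<^sup>2) \<partial>lborel)"
    using nn_integral_normal_density[OF \<open>\<delta> > 0\<close>] by (simp add: N(2) nn_integral_cmult)
  also have "(\<integral>\<^sup>+ p. ennreal (pi * (cmod (h (snd p)))\<^sup>2) * ennreal (?N (fst p) (snd p)) \<partial>lborel)
      = (\<integral>\<^sup>+ t. \<integral>\<^sup>+ s. ennreal (pi * (cmod (h t))\<^sup>2) * ennreal (?N s t) \<partial>lborel \<partial>lborel)"
    unfolding lborel_prod[symmetric] normal_density_def
    by (subst lborel_pair.nn_integral_snd[symmetric]) simp_all
  also have "\<dots> = (\<integral>\<^sup>+ s. ennreal (pi * (cmod (h s))\<^sup>2) \<partial>lborel)"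
    using nn_integral_normal_density[OF \<open>\<delta> > 0\<close>] by (simp add: nn_integral_cmult)
  also have "(\<integral>\<^sup>+ s. ennreal (pi * (cmod (h s))\<^sup>2) \<partial>lborel) + (\<integral>\<^sup>+ s. ennreal (pi * (cmod (h s))\<^sup>2) \<partial>lborel)
      = ennreal (2 * pi * (LINT x|lborel. (cmod (h x))\<^sup>2))"
    using h2 by (subst (1 2) nn_integral_eq_integral) (auto simp: ennreal_plus[symmetric] simp del: ennreal_plus)
  finally have "ennreal ?I \<le> ennreal (2 * pi * (LINT x|lborel. (cmod (h x))\<^sup>2))" .
  moreover have "(\<integral>\<^sup>+ w. ennreal (exp (- (\<delta> * w)\<^sup>2 / 2) * (cmod (fourier_integral h w))\<^sup>2) \<partial>lborel) = ennreal ?I"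
    by (rule nn_integral_eq_integral[OF iw]) simp
  ultimately show ?thesis by simp
qed

text \<open>Serves twice: to remove the Gaussian weight, and to let the outer truncation bound tend
  to infinity. In the second case the bound holds only for large \<open>n\<close>, hence the
  eventual form.\<close>

lemma nn_integral_Fatou_bound:
  fixes u :: "nat \<Rightarrow> 'a \<Rightarrow> ennreal"
  assumes "\<And>n. u n \<in> borel_measurable M" and "\<And>x. (\<lambda>n. u n x) \<longlonglongrightarrow> v x"
    and "eventually (\<lambda>n. (\<integral>\<^sup>+ x. u n x \<partial>M) \<le> C) sequentially"
  shows "(\<integral>\<^sup>+ x. v x \<partial>M) \<le> C"
proof -
  have "(\<integral>\<^sup>+ x. v x \<partial>M) = (\<integral>\<^sup>+ x. liminf (\<lambda>n. u n x) \<partial>M)"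
    using lim_imp_Liminf[OF trivial_limit_sequentially assms(2)] by simp
  also have "\<dots> \<le> liminf (\<lambda>n. \<integral>\<^sup>+ x. u n x \<partial>M)"
    using assms(1) by (rule nn_integral_liminf)
  also have "\<dots> \<le> C"
    using Liminf_mono[OF assms(3)] by (simp add: Liminf_const)
  finally show ?thesis .
qed

lemma fourier_integral_measurable [measurable]:
  assumes [measurable]: "h \<in> borel_measurable borel"
  shows "fourier_integral h \<in> borel_measurable borel"
  unfolding fourier_integral_def by measurable

text \<open>The weighted bound is uniform in \<open>\<delta>\<close>. For
  \<open>\<delta> = 1 / (n + 1)\<close> the weight tends to 1, and Fatou's lemma removes it.\<close>

lemma fourier_integral_Plancherel_le:
  assumes h: "integrable lborel h" and h2: "integrable lborel (\<lambda>x. (cmod (h x))\<^sup>2)"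
  shows "(\<integral>\<^sup>+ w. ennreal ((cmod (fourier_integral h w))\<^sup>2) \<partial>lborel)
       \<le> ennreal (2 * pi * (LINT x|lborel. (cmod (h x))\<^sup>2))"
proof (rule nn_integral_Fatou_bound)
  have [measurable]: "h \<in> borel_measurable borel" using h by (auto dest: borel_measurable_integrable)
  let ?u = "\<lambda>n w. ennreal (exp (- (inverse (real (Suc n)) * w)\<^sup>2 / 2) * (cmod (fourier_integral h w))\<^sup>2)"
  show "?u n \<in> borel_measurable lborel" for n by measurable
  show "(\<lambda>n. ?u n w) \<longlonglongrightarrow> ennreal ((cmod (fourier_integral h w))\<^sup>2)" for w
  proof (rule tendsto_ennrealI)
    have "(\<lambda>n. exp (- (inverse (real (Suc n)) * w)\<^sup>2 / 2) * (cmod (fourier_integral h w))\<^sup>2)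
        \<longlonglongrightarrow> exp (- (0 * w)\<^sup>2 / 2) * (cmod (fourier_integral h w))\<^sup>2"
      by (intro tendsto_intros LIMSEQ_inverse_real_of_nat) auto
    then show "(\<lambda>n. exp (- (inverse (real (Suc n)) * w)\<^sup>2 / 2) * (cmod (fourier_integral h w))\<^sup>2)
        \<longlonglongrightarrow> (cmod (fourier_integral h w))\<^sup>2" by simp
  qed
  show "eventually (\<lambda>n. (\<integral>\<^sup>+ w. ?u n w \<partial>lborel) \<le> ennreal (2 * pi * (LINT x|lborel. (cmod (h x))\<^sup>2))) sequentially"
    by (intro always_eventually allI fourier_integral_gaussian_norm h h2) auto
qed

subsection \<open>Regularity of Fourier integrals\<close>

lemma fourier_integral_continuous:
  assumes h: "integrable lborel h"
  shows "continuous_on UNIV (fourier_integral h)"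
proof (intro continuous_at_imp_continuous_on ballI continuous_at_sequentiallyI)
  have [measurable]: "h \<in> borel_measurable borel" using h by (auto dest: borel_measurable_integrable)
  fix w :: real and u :: "nat \<Rightarrow> real" assume u: "u \<longlonglongrightarrow> w"
  show "(\<lambda>n. fourier_integral h (u n)) \<longlonglongrightarrow> fourier_integral h w"
    unfolding fourier_integral_def
  proof (rule integral_dominated_convergence[where w = "\<lambda>t. norm (h t)"])
    show "AE t in lborel. (\<lambda>n. h t * fourier_kernel (u n) t) \<longlonglongrightarrow> h t * fourier_kernel w t"
      unfolding fourier_kernel_def by (intro AE_I2 tendsto_intros u)
  qed (use h in \<open>auto simp: norm_mult\<close>)
qed

lemma fourier_kernel_has_vector_derivative:
  "((\<lambda>w. fourier_kernel w t) has_vector_derivative - \<i> * of_real t * fourier_kernel w t) (at w)"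
  "((\<lambda>t. fourier_kernel w t) has_vector_derivative - \<i> * of_real w * fourier_kernel w t) (at t)"
proof -
  have "((\<lambda>w. - \<i> * of_real t * of_real w) has_vector_derivative - \<i> * of_real t) (at w)"
    using has_vector_derivative_mult_right[OF has_vector_derivative_of_real[OF DERIV_ident], of "- \<i> * of_real t"] by simp
  from field_vector_diff_chain_at[OF this DERIV_exp]
  show "((\<lambda>w. fourier_kernel w t) has_vector_derivative - \<i> * of_real t * fourier_kernel w t) (at w)"
    by (simp add: fourier_kernel_def o_def)
next
  have "((\<lambda>t. - \<i> * of_real w * of_real t) has_vector_derivative - \<i> * of_real w) (at t)"
    using has_vector_derivative_mult_right[OF has_vector_derivative_of_real[OF DERIV_ident], of "- \<i> * of_real w"] by simp
  from field_vector_diff_chain_at[OF this DERIV_exp]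
  show "((\<lambda>t. fourier_kernel w t) has_vector_derivative - \<i> * of_real w * fourier_kernel w t) (at t)"
    by (simp add: fourier_kernel_def o_def mult_ac)
qed

lemma norm_fourier_kernel_diff_le:
  "norm (fourier_kernel y t - fourier_kernel w t) \<le> \<bar>y - w\<bar> * \<bar>t\<bar>"
proof -
  have "fourier_kernel y t - fourier_kernel w t = fourier_kernel w t * (iexp (- t * (y - w)) - 1)"
    by (simp add: fourier_kernel_def algebra_simps exp_add[symmetric] exp_diff exp_minus inverse_eq_divide)
  then have "norm (fourier_kernel y t - fourier_kernel w t) = norm (iexp (- t * (y - w)) - 1)"
    by (simp only: norm_mult norm_fourier_kernel mult_1)
  also have "\<dots> \<le> \<bar>- t * (y - w)\<bar>"
    using iexp_approx1[of "- t * (y - w)" 0] by simp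
  finally show ?thesis by (simp add: abs_mult mult.commute)
qed

text \<open>Differentiation under the integral sign. The normalised Taylor remainder
  \<open>q\<close> of the kernel tends to 0 for each \<open>t\<close>, and
  \<open>2 * \<bar>t\<bar>\<close> bounds it uniformly in \<open>y\<close>: one
  \<open>\<bar>t\<bar>\<close> from the Lipschitz estimate, one from the linear term. So the first
  moment of \<open>h\<close> is the dominating function.\<close>

lemma fourier_integral_has_vector_derivative:
  assumes h: "integrable lborel h" and th: "integrable lborel (\<lambda>t. of_real t * h t)"
  shows "(fourier_integral h has_vector_derivative
          - \<i> * fourier_integral (\<lambda>t. of_real t * h t) w) (at w)"
proof -
  have [measurable]: "h \<in> borel_measurable borel" using h by (auto dest: borel_measurable_integrable)
  define q where "q = (\<lambda>y t. (1 / norm (y - w)) *\<^sub>R (fourier_kernel y t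
      - (fourier_kernel w t + (y - w) *\<^sub>R (- \<i> * of_real t * fourier_kernel w t))))"
  let ?D = "- \<i> * fourier_integral (\<lambda>t. of_real t * h t) w"
  have q: "(1 / norm (y - w)) *\<^sub>R (fourier_integral h y - (fourier_integral h w + (y - w) *\<^sub>R ?D))
      = (LINT t|lborel. h t * q y t)" for y
  proof -
    note i = integrable_mult_fourier_kernel[OF h] integrable_mult_fourier_kernel[OF th]
    have "(LINT t|lborel. h t * q y t) = (LINT t|lborel. (1 / norm (y - w)) *\<^sub>R (h t * fourier_kernel y t
      - (h t * fourier_kernel w t + (y - w) *\<^sub>R (- \<i> * ((of_real t * h t) * fourier_kernel w t)))))"
      by (simp add: q_def scaleR_conv_of_real algebra_simps)
    also have "\<dots> = (1 / norm (y - w)) *\<^sub>R (fourier_integral h y - (fourier_integral h w + (y - w) *\<^sub>R ?D))"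
      unfolding fourier_integral_def using i by simp
    finally show ?thesis by simp
  qed
  have "((\<lambda>y. LINT t|lborel. h t * q y t) \<longlongrightarrow> 0) (at w)"
    unfolding tendsto_at_iff_sequentially
  proof (intro allI impI)
    fix u :: "nat \<Rightarrow> real" assume u: "\<forall>i. u i \<in> UNIV - {w}" "u \<longlonglongrightarrow> w"
    have "(\<lambda>n. LINT t|lborel. h t * q (u n) t) \<longlonglongrightarrow> (LINT t|(lborel::real measure). 0)"
    proof (rule integral_dominated_convergence[where w = "\<lambda>t. 2 * norm (of_real t * h t)"])
      show "AE t in lborel. (\<lambda>n. h t * q (u n) t) \<longlonglongrightarrow> 0"
      proof (rule AE_I2)
        fix t
        have "((\<lambda>y. q y t) \<longlongrightarrow> 0) (at w)"
          using fourier_kernel_has_vector_derivative(1)[of t w]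
          unfolding has_vector_derivative_def has_derivative_within q_def by simp
        then have "(\<lambda>n. q (u n) t) \<longlonglongrightarrow> 0"
          using u unfolding tendsto_at_iff_sequentially by (auto simp: o_def)
        then show "(\<lambda>n. h t * q (u n) t) \<longlonglongrightarrow> 0" by (rule tendsto_mult_right_zero)
      qed
      show "AE t in lborel. norm (h t * q (u n) t) \<le> 2 * norm (of_real t * h t)" for n
      proof (rule AE_I2)
        fix t
        let ?y = "u n"
        have ne: "\<bar>?y - w\<bar> > 0" using u by auto
        have "norm (fourier_kernel ?y t - (fourier_kernel w t + (?y - w) *\<^sub>R (- \<i> * of_real t * fourier_kernel w t)))
            \<le> norm (fourier_kernel ?y t - fourier_kernel w t) + norm ((?y - w) *\<^sub>R (- \<i> * of_real t * fourier_kernel w t))"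
          using norm_triangle_ineq4[of "fourier_kernel ?y t - fourier_kernel w t"] by (metis diff_diff_eq)
        also have "\<dots> \<le> \<bar>?y - w\<bar> * (2 * \<bar>t\<bar>)"
          using norm_fourier_kernel_diff_le[of ?y t w] by (simp add: norm_mult mult_ac)
        finally have "norm (q ?y t) \<le> 2 * \<bar>t\<bar>"
          unfolding q_def using ne by (simp add: divide_simps mult.commute)
        then have "norm (h t) * norm (q ?y t) \<le> norm (h t) * (2 * \<bar>t\<bar>)" by (rule mult_left_mono) simp
        then show "norm (h t * q ?y t) \<le> 2 * norm (of_real t * h t)"
          by (simp add: norm_mult mult_ac)
      qed
      show "(\<lambda>t. h t * q (u n) t) \<in> borel_measurable lborel" for n
        unfolding q_def by measurable
    qed (use th in auto)
    then show "((\<lambda>y. LINT t|lborel. h t * q y t) \<circ> u) \<longlonglongrightarrow> 0" by (simp add: o_def)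
  qed
  then show ?thesis
    unfolding has_vector_derivative_def has_derivative_within
    by (simp only: q bounded_linear_scaleR_left simp_thms)
qed

section \<open>Truncated integrals and decay at infinity\<close>

lemma tendsto_integral_Icc_at_top:
  fixes F :: "real \<Rightarrow> 'a::{banach, second_countable_topology}"
  assumes F: "integrable lborel F"
  shows "((\<lambda>R. LINT t:{-R..R}|lborel. F t) \<longlongrightarrow> integral\<^sup>L lborel F) at_top"
  unfolding set_lebesgue_integral_def
proof (rule integral_dominated_convergence_at_top[where w = "\<lambda>t. norm (F t)"])
  have [measurable]: "F \<in> borel_measurable borel" using F by (auto dest: borel_measurable_integrable)
  show "AE t in lborel. ((\<lambda>R. indicator {-R..R} t *\<^sub>R F t) \<longlongrightarrow> F t) at_top"
  proof (rule AE_I2, rule tendsto_eventually)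
    fix t show "eventually (\<lambda>R. indicator {-R..R} t *\<^sub>R F t = F t) at_top"
      using eventually_ge_at_top[of "\<bar>t\<bar>"] by eventually_elim (auto simp: indicator_def abs_le_iff)
  qed
  show "F \<in> borel_measurable lborel" "\<And>R. (\<lambda>t. indicator {-R..R} t *\<^sub>R F t) \<in> borel_measurable lborel"
    by measurable
qed (use F in \<open>auto simp: indicator_def intro!: always_eventually\<close>)

lemma tendsto_tail_integral_at_top:
  fixes F :: "real \<Rightarrow> 'a::{banach, second_countable_topology}"
  assumes F: "integrable lborel F"
  shows "((\<lambda>R. LINT t:- {-R..R}|lborel. F t) \<longlongrightarrow> 0) at_top"
proof -
  have [measurable]: "F \<in> borel_measurable borel" using F by (auto dest: borel_measurable_integrable)
  have "(LINT t:- {-R..R}|lborel. F t) = integral\<^sup>L lborel F - (LINT t:{-R..R}|lborel. F t)" for R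
  proof -
    have "integrable lborel (\<lambda>t. indicator {-R..R} t *\<^sub>R F t)"
      using F by (intro integrable_mult_indicator) auto
    then have "integral\<^sup>L lborel F - (LINT t:{-R..R}|lborel. F t) = (LINT t|lborel. F t - indicator {-R..R} t *\<^sub>R F t)"
      using F by (simp add: set_lebesgue_integral_def)
    also have "\<dots> = (LINT t:- {-R..R}|lborel. F t)"
      unfolding set_lebesgue_integral_def by (rule Bochner_Integration.integral_cong) (auto simp: indicator_def)
    finally show ?thesis by simp
  qed
  then show ?thesis
    using tendsto_diff[OF tendsto_const tendsto_integral_Icc_at_top[OF F], of "integral\<^sup>L lborel F"] by simp
qed

lemma integrable_powr_at_top:
  fixes a R :: real
  assumes "a < -1" "R > 0"
  shows "integrable lborel (\<lambda>x. indicator {R..} x * x powr a)"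
proof (rule integrableI_nonneg)
  have "((\<lambda>x. x powr (a + 1) / (a + 1)) \<longlongrightarrow> 0) at_top"
    using tendsto_neg_powr[of "a + 1" "\<lambda>x. x" at_top] assms
    by (auto intro!: tendsto_divide_zero filterlim_ident)
  moreover have "((\<lambda>x. x powr (a + 1) / (a + 1)) has_real_derivative x powr a) (at x)" if "R \<le> x" for x
    using DERIV_cdivide[OF has_real_derivative_powr[of x "a + 1"], of "a + 1"] assms that by simp
  ultimately have "(\<integral>\<^sup>+x. ennreal (x powr a) * indicator {R..} x \<partial>lborel) = 0 - R powr (a + 1) / (a + 1)"
    using assms
    by (intro nn_integral_FTC_atLeast) auto
  moreover have "ennreal (indicator {R..} x * x powr a) = ennreal (x powr a) * indicator {R..} x" for x
    by (auto simp: indicator_def)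
  ultimately show "(\<integral>\<^sup>+x. ennreal (indicator {R..} x * x powr a) \<partial>lborel) < \<infinity>"
    by simp
qed auto

text \<open>Of the exponent \<open>2 + \<epsilon>\<close>, one power of \<open>\<bar>x\<bar>\<close>
  pays for the weight \<open>1 + \<bar>x\<bar>\<close>; the remaining
  \<open>\<bar>x\<bar> powr (- 1 - \<epsilon>)\<close> is still integrable at infinity.\<close>

lemma integrable_of_decay:
  fixes f :: "real \<Rightarrow> complex"
  assumes f: "continuous_on UNIV f" and "\<epsilon> > 0"
    and lim: "((\<lambda>x. cmod (f x * of_real (\<bar>x\<bar> powr (2 + \<epsilon>)))) \<longlongrightarrow> 0) at_infinity"
  shows "integrable lborel f" and "integrable lborel (\<lambda>x. of_real x * f x)"
    and "((\<lambda>x. (1 + \<bar>x\<bar>) * cmod (f x)) \<longlongrightarrow> 0) at_infinity"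
proof -
  from lim have "eventually (\<lambda>x. cmod (f x) * \<bar>x\<bar> powr (2 + \<epsilon>) < 1) at_infinity"
    by (auto dest!: order_tendstoD(2)[of _ _ _ 1] simp: norm_mult)
  then obtain R0 where R0: "\<And>x. \<bar>x\<bar> \<ge> R0 \<Longrightarrow> cmod (f x) * \<bar>x\<bar> powr (2 + \<epsilon>) < 1"
    by (auto simp: eventually_at_infinity)
  define R where "R = max 1 R0"
  have R: "cmod (f x) * \<bar>x\<bar> powr (2 + \<epsilon>) \<le> 1" if "\<bar>x\<bar> \<ge> R" for x
    using R0[of x] that by (auto simp: R_def)
  have R1: "R \<ge> 1" by (simp add: R_def)
  have dec: "(1 + \<bar>x\<bar>) * cmod (f x) \<le> 2 * \<bar>x\<bar> powr (- 1 - \<epsilon>)" if "\<bar>x\<bar> \<ge> R" for x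
  proof -
    have x: "\<bar>x\<bar> \<ge> 1" using that R1 by simp
    then have "\<bar>x\<bar> powr (2 + \<epsilon>) * \<bar>x\<bar> powr (- 1 - \<epsilon>) = \<bar>x\<bar>"
      by (simp add: powr_add[symmetric])
    then have "\<bar>x\<bar> * cmod (f x) = (cmod (f x) * \<bar>x\<bar> powr (2 + \<epsilon>)) * \<bar>x\<bar> powr (- 1 - \<epsilon>)"
      by (simp add: mult_ac)
    also have "\<dots> \<le> 1 * \<bar>x\<bar> powr (- 1 - \<epsilon>)" using R[OF that] by (intro mult_right_mono) auto
    finally have "\<bar>x\<bar> * cmod (f x) \<le> \<bar>x\<bar> powr (- 1 - \<epsilon>)" by simp
    moreover have "1 * cmod (f x) \<le> \<bar>x\<bar> * cmod (f x)" using x by (intro mult_right_mono) auto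
    ultimately show ?thesis by (simp add: algebra_simps)
  qed
  have [measurable]: "f \<in> borel_measurable borel" using f by (rule borel_measurable_continuous_onI)
  have "continuous_on {-R..R} (\<lambda>x. (1 + \<bar>x\<bar>) * cmod (f x))"
    by (intro continuous_intros continuous_on_subset[OF f]) auto
  then have i1: "integrable lborel (\<lambda>x. indicator {-R..R} x *\<^sub>R ((1 + \<bar>x\<bar>) * cmod (f x)))"
    by (intro borel_integrable_compact) auto
  have i2: "integrable lborel (\<lambda>x. indicator {R..} x * x powr (- 1 - \<epsilon>))"
    using R1 \<open>\<epsilon> > 0\<close> by (intro integrable_powr_at_top) auto
  have i3: "integrable lborel (\<lambda>x. indicator {R..} (- x) * (- x) powr (- 1 - \<epsilon>))"
    using lborel_integrable_real_affine[OF i2, of "-1" 0] by simp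
  \<comment> \<open>One majorant serves both integrability claims: continuity controls the compact
    middle, and the left tail is the reflected right tail. The indicators confine
    \<open>powr\<close> to positive bases.\<close>
  let ?b = "\<lambda>x. indicator {-R..R} x *\<^sub>R ((1 + \<bar>x\<bar>) * cmod (f x)) + 2 * (indicator {R..} x * x powr (- 1 - \<epsilon>))
      + 2 * (indicator {R..} (- x) * (- x) powr (- 1 - \<epsilon>))"
  have ib: "integrable lborel ?b" using i1 i2 i3 by auto
  have b: "(1 + \<bar>x\<bar>) * cmod (f x) \<le> ?b x" for x
    using dec[of x] R1 by (auto simp: indicator_def abs_if split: if_splits)
  have b1: "cmod (f x) \<le> ?b x" "\<bar>x\<bar> * cmod (f x) \<le> ?b x" "0 \<le> ?b x" for x
  proof -
    show "cmod (f x) \<le> ?b x" using b[of x] by (rule order_trans[rotated]) (simp add: algebra_simps)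
    show "\<bar>x\<bar> * cmod (f x) \<le> ?b x" using b[of x] by (rule order_trans[rotated]) (simp add: algebra_simps)
    show "0 \<le> ?b x" using b[of x] by (rule order_trans[rotated]) simp
  qed
  show "integrable lborel f"
    using ib by (rule Bochner_Integration.integrable_bound) (use b1 in auto)
  show "integrable lborel (\<lambda>x. of_real x * f x)"
    using ib by (rule Bochner_Integration.integrable_bound) (use b1 in \<open>auto simp: norm_mult\<close>)
  show "((\<lambda>x. (1 + \<bar>x\<bar>) * cmod (f x)) \<longlongrightarrow> 0) at_infinity"
  proof (rule Lim_null_comparison)
    show "eventually (\<lambda>x. norm ((1 + \<bar>x\<bar>) * cmod (f x)) \<le> 2 * \<bar>x\<bar> powr (- 1 - \<epsilon>)) at_infinity"
      using dec by (auto simp: eventually_at_infinity abs_mult)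
    have "filterlim (\<lambda>x::real. \<bar>x\<bar>) at_top at_infinity"
      using filterlim_norm_at_top[where 'a = real] by (simp add: real_norm_def[abs_def])
    then have "((\<lambda>x::real. \<bar>x\<bar> powr (- 1 - \<epsilon>)) \<longlongrightarrow> 0) at_infinity"
      using \<open>\<epsilon> > 0\<close> by (intro tendsto_neg_powr) auto
    then show "((\<lambda>x::real. 2 * \<bar>x\<bar> powr (- 1 - \<epsilon>)) \<longlongrightarrow> 0) at_infinity"
      by (rule tendsto_mult_right_zero)
  qed
qed

subsection \<open>The \<open>L\<^sub>2\<close> Fourier transform\<close>

text \<open>Uses \<open>x \<le> 1 + x\<^sup>2\<close>, where the constant is integrable over a
  bounded interval. It turns every truncated transform into an absolutely convergent Fourier
  integral, to which the Plancherel inequality applies.\<close>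

lemma L2_integrable_Icc:
  fixes g :: "real \<Rightarrow> complex"
  assumes g: "L2 g"
  shows "integrable lborel (\<lambda>t. indicator {u..v} t *\<^sub>R g t)"
proof -
  have [measurable]: "g \<in> borel_measurable borel" and g2: "integrable lborel (\<lambda>t. (cmod (g t))\<^sup>2)"
    using g by (auto simp: L2_def)
  have "integrable lborel (\<lambda>t. indicator {u..v} t *\<^sub>R (1::real))"
    by (intro borel_integrable_compact) auto
  then have b: "integrable lborel (\<lambda>t. indicator {u..v} t *\<^sub>R (1::real) + (cmod (g t))\<^sup>2)"
    using g2 by auto
  show "integrable lborel (\<lambda>t. indicator {u..v} t *\<^sub>R g t)"
  proof (rule Bochner_Integration.integrable_bound[OF b])
    have "x \<le> 1 + x\<^sup>2" if "x \<ge> 0" for x :: real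
      using sum_squares_bound[of x 1] that by (simp add: power2_eq_square)
    then show "AE t in lborel. norm (indicator {u..v} t *\<^sub>R g t) \<le> norm (indicator {u..v} t *\<^sub>R (1::real) + (cmod (g t))\<^sup>2)"
      by (auto simp: indicator_def)
  qed measurable
qed

lemma truncated_fourier_integral:
  "(LINT t:{-R..R}|lborel. g t * exp (- \<i> * of_real t * of_real w))
   = fourier_integral (\<lambda>t. indicator {-R..R} t *\<^sub>R g t) w"
  by (simp add: set_lebesgue_integral_def fourier_integral_def fourier_kernel_def)

text \<open>Once the truncated transforms converge pointwise, Fatou's lemma upgrades the Plancherel
  inequality for the increments to convergence in \<open>L\<^sub>2\<close>, so that completeness of \<open>L\<^sub>2\<close>
  is not needed.\<close>

lemma truncated_fourier_error:
  assumes g: "L2 g" and "0 \<le> R"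
    and lim: "\<And>w. ((\<lambda>R. fourier_integral (\<lambda>t. indicator {-R..R} t *\<^sub>R g t) w) \<longlongrightarrow> H w) at_top"
  shows "(\<integral>\<^sup>+ w. ennreal ((cmod (H w - fourier_integral (\<lambda>t. indicator {-R..R} t *\<^sub>R g t) w))\<^sup>2) \<partial>lborel)
     \<le> ennreal (2 * pi * (LINT t:- {-R..R}|lborel. (cmod (g t))\<^sup>2))"
proof (rule nn_integral_Fatou_bound)
  have [measurable]: "g \<in> borel_measurable borel" and g2: "integrable lborel (\<lambda>t. (cmod (g t))\<^sup>2)"
    using g by (auto simp: L2_def)
  let ?T = "\<lambda>R. fourier_integral (\<lambda>t. indicator {-R..R} t *\<^sub>R g t)"
  let ?u = "\<lambda>n w. ennreal ((cmod (?T (real n) w - ?T R w))\<^sup>2)"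
  show "?u n \<in> borel_measurable lborel" for n by measurable
  show "(\<lambda>n. ?u n w) \<longlonglongrightarrow> ennreal ((cmod (H w - ?T R w))\<^sup>2)" for w
    by (intro tendsto_ennrealI tendsto_intros filterlim_compose[OF lim filterlim_real_sequentially])
  show "eventually (\<lambda>n. (\<integral>\<^sup>+ w. ?u n w \<partial>lborel) \<le> ennreal (2 * pi * (LINT t:- {-R..R}|lborel. (cmod (g t))\<^sup>2))) sequentially"
    using eventually_ge_at_top[of "nat \<lceil>R\<rceil>"]
  proof eventually_elim
    case (elim n)
    then have n: "R \<le> real n" by linarith
    \<comment> \<open>Since \<open>R \<le> n\<close>, this is \<open>g\<close> restricted to the
      points with \<open>R < \<bar>t\<bar> \<le> n\<close>; its squared norm is at most the tail of
      \<open>g\<close> beyond \<open>R\<close>, whatever \<open>n\<close> is.\<close>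
    let ?h = "\<lambda>t. indicator {-real n..real n} t *\<^sub>R g t - indicator {-R..R} t *\<^sub>R g t"
    note i = L2_integrable_Icc[OF g]
    have h: "integrable lborel ?h" using i by auto
    have "integrable lborel (\<lambda>t. indicator (- {-R..R}) t *\<^sub>R (cmod (g t))\<^sup>2)"
      by (intro integrable_mult_indicator g2) auto
    moreover have le: "(cmod (?h t))\<^sup>2 \<le> indicator (- {-R..R}) t *\<^sub>R (cmod (g t))\<^sup>2" for t
      using n by (auto simp: indicator_def)
    ultimately have h2: "integrable lborel (\<lambda>t. (cmod (?h t))\<^sup>2)"
      and le2: "(LINT t|lborel. (cmod (?h t))\<^sup>2) \<le> (LINT t:- {-R..R}|lborel. (cmod (g t))\<^sup>2)"
    proof -
      assume i2: "integrable lborel (\<lambda>t. indicator (- {-R..R}) t *\<^sub>R (cmod (g t))\<^sup>2)"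
      show *: "integrable lborel (\<lambda>t. (cmod (?h t))\<^sup>2)"
        by (rule Bochner_Integration.integrable_bound[OF i2]) (use le in \<open>auto intro: order_trans[OF _ abs_ge_self]\<close>)
      show "(LINT t|lborel. (cmod (?h t))\<^sup>2) \<le> (LINT t:- {-R..R}|lborel. (cmod (g t))\<^sup>2)"
        unfolding set_lebesgue_integral_def by (rule integral_mono[OF * i2 le])
    qed
    have "?T (real n) w - ?T R w = fourier_integral ?h w" for w
      using integrable_mult_fourier_kernel[OF i] by (simp add: fourier_integral_def left_diff_distrib)
    then have "(\<integral>\<^sup>+ w. ?u n w \<partial>lborel) \<le> ennreal (2 * pi * (LINT t|lborel. (cmod (?h t))\<^sup>2))"
      using fourier_integral_Plancherel_le[OF h h2] by simp
    also have "\<dots> \<le> ennreal (2 * pi * (LINT t:- {-R..R}|lborel. (cmod (g t))\<^sup>2))"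
      using le2 by (intro ennreal_leI mult_left_mono) auto
    finally show ?case .
  qed
qed

lemma is_L2_fourier_of_pointwise:
  assumes g: "L2 g" and H: "H \<in> borel_measurable borel"
    and lim: "\<And>w. ((\<lambda>R. fourier_integral (\<lambda>t. indicator {-R..R} t *\<^sub>R g t) w) \<longlongrightarrow> H w) at_top"
  shows "is_L2_fourier g H"
proof -
  have g2: "integrable lborel (\<lambda>t. (cmod (g t))\<^sup>2)" using g by (simp add: L2_def)
  \<comment> \<open>With \<open>R = 0\<close> the truncation lives on a single point and its
    transform vanishes, so the error estimate becomes a finite bound on the norm of \<open>H\<close>
    itself.\<close>
  have T0: "fourier_integral (\<lambda>t. indicator {-0..0} t *\<^sub>R g t) w = 0" for w
  proof -
    have "AE t in lborel. indicator {-0..0} t *\<^sub>R g t * fourier_kernel w t = 0"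
      using AE_lborel_singleton[of "0::real"] by eventually_elim (simp add: indicator_def)
    then show ?thesis unfolding fourier_integral_def by (rule integral_eq_zero_AE)
  qed
  have "(\<integral>\<^sup>+ w. ennreal ((cmod (H w))\<^sup>2) \<partial>lborel) < \<infinity>"
    using truncated_fourier_error[OF g order_refl lim] unfolding T0 diff_zero
    by (rule le_less_trans) simp
  then have "integrable lborel (\<lambda>w. (cmod (H w))\<^sup>2)"
    using H by (intro integrableI_nonneg) auto
  then have "L2 H" using H by (simp add: L2_def)
  moreover have "((\<lambda>R. \<integral>\<^sup>+ w. ennreal ((cmod (H w - fourier_integral (\<lambda>t. indicator {-R..R} t *\<^sub>R g t) w))\<^sup>2) \<partial>lborel) \<longlongrightarrow> 0) at_top"
  proof (rule tendsto_sandwich[OF _ _ tendsto_const])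
    show "eventually (\<lambda>R. (\<integral>\<^sup>+ w. ennreal ((cmod (H w - fourier_integral (\<lambda>t. indicator {-R..R} t *\<^sub>R g t) w))\<^sup>2) \<partial>lborel)
        \<le> ennreal (2 * pi * (LINT t:- {-R..R}|lborel. (cmod (g t))\<^sup>2))) at_top"
      using eventually_ge_at_top[of 0] by eventually_elim (rule truncated_fourier_error[OF g _ lim])
    have "((\<lambda>R. ennreal (2 * pi * (LINT t:- {-R..R}|lborel. (cmod (g t))\<^sup>2))) \<longlongrightarrow> ennreal (2 * pi * 0)) at_top"
      by (intro tendsto_ennrealI tendsto_mult_left tendsto_tail_integral_at_top g2)
    then show "((\<lambda>R. ennreal (2 * pi * (LINT t:- {-R..R}|lborel. (cmod (g t))\<^sup>2))) \<longlongrightarrow> 0) at_top" by simp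
  qed auto
  ultimately show ?thesis unfolding is_L2_fourier_def truncated_fourier_integral by blast
qed

text \<open>Both functions are L2 limits of the same truncated transforms. The triangle inequality
  is applied pointwise in the squared form
  \<open>(a + b)\<^sup>2 \<le> 2 * (a\<^sup>2 + b\<^sup>2)\<close>, which suits nonnegative
  integrals.\<close>

lemma is_L2_fourier_unique:
  assumes g: "L2 g" and F: "is_L2_fourier g F" and G: "is_L2_fourier g G"
  shows "AE w in lborel. F w = G w"
proof -
  let ?T = "\<lambda>R. fourier_integral (\<lambda>t. indicator {-R..R} t *\<^sub>R g t)"
  have [measurable]: "g \<in> borel_measurable borel" "F \<in> borel_measurable borel" "G \<in> borel_measurable borel"
    using g F G by (auto simp: L2_def is_L2_fourier_def)
  let ?E = "\<lambda>F R. \<integral>\<^sup>+ w. ennreal ((cmod (F w - ?T R w))\<^sup>2) \<partial>lborel"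
  have lim: "((\<lambda>R. 2 * (?E F R + ?E G R)) \<longlongrightarrow> 2 * (0 + 0)) at_top"
    using F G unfolding is_L2_fourier_def truncated_fourier_integral
    by (intro ennreal_tendsto_cmult tendsto_add) auto
  have le: "(\<integral>\<^sup>+ w. ennreal ((cmod (F w - G w))\<^sup>2) \<partial>lborel) \<le> 2 * (?E F R + ?E G R)" for R
  proof -
    have "(cmod (F w - G w))\<^sup>2 \<le> 2 * ((cmod (F w - ?T R w))\<^sup>2 + (cmod (G w - ?T R w))\<^sup>2)" for w
    proof -
      have "cmod (F w - G w) \<le> cmod (F w - ?T R w) + cmod (G w - ?T R w)"
        using norm_triangle_ineq4[of "F w - ?T R w" "G w - ?T R w"] by simp
      then have "(cmod (F w - G w))\<^sup>2 \<le> (cmod (F w - ?T R w) + cmod (G w - ?T R w))\<^sup>2"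
        by (rule power_mono) simp
      also have "\<dots> \<le> 2 * ((cmod (F w - ?T R w))\<^sup>2 + (cmod (G w - ?T R w))\<^sup>2)"
        using sum_squares_bound[of "cmod (F w - ?T R w)" "cmod (G w - ?T R w)"]
        by (simp add: power2_sum)
      finally show ?thesis .
    qed
    then have "ennreal ((cmod (F w - G w))\<^sup>2) \<le> ennreal (2 * ((cmod (F w - ?T R w))\<^sup>2 + (cmod (G w - ?T R w))\<^sup>2))" for w
      by (rule ennreal_leI)
    moreover have "ennreal (2 * (a\<^sup>2 + b\<^sup>2)) = 2 * (ennreal (a\<^sup>2) + ennreal (b\<^sup>2))" for a b :: real
      by (simp add: ennreal_mult ennreal_plus)
    ultimately have "ennreal ((cmod (F w - G w))\<^sup>2) \<le> 2 * (ennreal ((cmod (F w - ?T R w))\<^sup>2) + ennreal ((cmod (G w - ?T R w))\<^sup>2))" for w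
      by metis
    then have "(\<integral>\<^sup>+ w. ennreal ((cmod (F w - G w))\<^sup>2) \<partial>lborel)
        \<le> (\<integral>\<^sup>+ w. 2 * (ennreal ((cmod (F w - ?T R w))\<^sup>2) + ennreal ((cmod (G w - ?T R w))\<^sup>2)) \<partial>lborel)"
      by (rule nn_integral_mono)
    also have "\<dots> = 2 * (?E F R + ?E G R)"
      by (subst nn_integral_cmult, measurable, subst nn_integral_add) simp_all
    finally show ?thesis .
  qed
  have "(\<integral>\<^sup>+ w. ennreal ((cmod (F w - G w))\<^sup>2) \<partial>lborel) \<le> 2 * (0 + 0)"
    by (rule tendsto_lowerbound[OF lim]) (use le in auto)
  then have "AE w in lborel. ennreal ((cmod (F w - G w))\<^sup>2) = 0"
    by (subst nn_integral_0_iff_AE[symmetric]) auto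
  then show ?thesis by eventually_elim auto
qed

lemma fourier_eq_fourier_integral: "integrable lborel f \<Longrightarrow> fourier f = fourier_integral f"
  by (simp add: fourier_def fourier_integral_def fourier_kernel_def fun_eq_iff)

text \<open>Unifies the two branches of \<open>fourier\<close>. For integrable \<open>g\<close> the
  limit of the truncations is the integral formula; otherwise \<open>H\<close> shows that the choice
  by \<open>SOME\<close> has a witness, and uniqueness ties the chosen function to
  \<open>H\<close>.\<close>

lemma fourier_of_pointwise:
  assumes g: "L2 g" and H: "H \<in> borel_measurable borel"
    and lim: "\<And>w. ((\<lambda>R. fourier_integral (\<lambda>t. indicator {-R..R} t *\<^sub>R g t) w) \<longlongrightarrow> H w) at_top"
  shows "fourier g \<in> borel_measurable borel" and "AE w in lborel. fourier g w = H w"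
proof -
  have "fourier g \<in> borel_measurable borel \<and> (AE w in lborel. fourier g w = H w)"
  proof (cases "integrable lborel g")
    case True
    have "fourier_integral g w = H w" for w
    proof (rule tendsto_unique[OF _ _ lim])
      show "((\<lambda>R. fourier_integral (\<lambda>t. indicator {-R..R} t *\<^sub>R g t) w) \<longlongrightarrow> fourier_integral g w) at_top"
        using tendsto_integral_Icc_at_top[OF integrable_mult_fourier_kernel[OF True, of w]]
        by (simp add: fourier_integral_def set_lebesgue_integral_def)
    qed simp
    then have "fourier_integral g = H" ..
    with True H show ?thesis by (simp add: fourier_eq_fourier_integral)
  next
    case False
    have "is_L2_fourier g H" by (rule is_L2_fourier_of_pointwise[OF assms])
    moreover from this have "is_L2_fourier g (fourier g)"
      using False by (simp add: fourier_def someI[of "is_L2_fourier g"])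
    ultimately show ?thesis
      using is_L2_fourier_unique[OF g] by (auto simp: is_L2_fourier_def L2_def)
  qed
  then show "fourier g \<in> borel_measurable borel" and "AE w in lborel. fourier g w = H w" by auto
qed

subsection \<open>First-order linear equations\<close>

text \<open>Links the two notions of null set: the equations hold almost everywhere for
  \<open>lborel\<close>, while the fundamental theorem of calculus is stated for the gauge integral
  and negligible sets.\<close>

lemma has_integral_cong_AE:
  fixes f g :: "'a::euclidean_space \<Rightarrow> 'b::real_normed_vector"
  assumes "AE x in lborel. x \<in> S \<longrightarrow> f x = g x" and "(f has_integral i) S"
  shows "(g has_integral i) S"
proof -
  have "AE x in lebesgue. x \<in> S \<longrightarrow> f x = g x" using AE_completion[OF assms(1)] .
  then obtain N where "negligible N" "{x. \<not> (x \<in> S \<longrightarrow> f x = g x)} \<subseteq> N"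
    unfolding eventually_ae_filter_negligible by blast
  then show ?thesis
    using has_integral_spike[OF _ _ assms(2), of N g] by fastforce
qed

lemma is_interval_imp_Icc_subset:
  fixes J :: "real set"
  assumes "is_interval J" "a \<in> J" "b \<in> J"
  shows "{a..b} \<subseteq> J"
  using mem_is_interval_1_I[OF assms] by auto

text \<open>The Cantor function shows that differentiability almost everywhere would not suffice.
  Here \<open>d\<close> is differentiable at every point of \<open>J\<close>, so the gauge integral
  recovers it from \<open>D\<close>, and \<open>D\<close> may be replaced by 0 off a null
  set.\<close>

lemma AE_zero_derivative_imp_constant:
  fixes d :: "real \<Rightarrow> 'a::banach"
  assumes J: "is_interval J" and d: "\<And>x. x \<in> J \<Longrightarrow> (d has_vector_derivative D x) (at x)"
    and D: "AE x in lborel. x \<in> J \<longrightarrow> D x = 0" and "u \<in> J" "v \<in> J"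
  shows "d u = d v"
proof -
  have *: "d u = d v" if "u \<le> v" "u \<in> J" "v \<in> J" for u v
  proof -
    have sub: "{u..v} \<subseteq> J" using is_interval_imp_Icc_subset[OF J] that by blast
    then have "(D has_integral (d v - d u)) {u..v}"
      by (intro fundamental_theorem_of_calculus \<open>u \<le> v\<close> has_vector_derivative_at_within[OF d]) blast
    moreover have "AE x in lborel. x \<in> {u..v} \<longrightarrow> D x = 0"
      using D by (rule eventually_mono) (use sub in auto)
    ultimately have "((\<lambda>x. 0) has_integral (d v - d u)) {u..v}"
      by (rule has_integral_cong_AE[rotated])
    then show ?thesis by (simp add: has_integral_0_eq)
  qed
  show ?thesis using *[OF _ assms(4,5)] *[OF _ assms(5,4)] linear[of u v] by metis
qed

lemma Icc_in_open_interval: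
  fixes J :: "real set"
  assumes "open J" "is_interval J" "c \<in> J" "x \<in> J"
  obtains a b where "a < c" "c < b" "a < x" "x < b" "{a..b} \<subseteq> J"
proof -
  have "min c x \<in> J" "max c x \<in> J" using assms by (auto simp: min_def max_def)
  then obtain e e' where e: "e > 0" "cball (min c x) e \<subseteq> J" "e' > 0" "cball (max c x) e' \<subseteq> J"
    using \<open>open J\<close> unfolding open_contains_cball by meson
  then have "min c x - e \<in> J" "max c x + e' \<in> J"
    by (auto simp: subset_eq dist_real_def)
  then have "{min c x - e..max c x + e'} \<subseteq> J"
    by (rule is_interval_imp_Icc_subset[OF \<open>is_interval J\<close>])
  with e show ?thesis by (intro that[of "min c x - e" "max c x + e'"]) auto
qed

lemma interval_integral_has_vector_derivative:
  fixes F :: "real \<Rightarrow> 'a::euclidean_space"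
  assumes J: "open J" "is_interval J" and F: "continuous_on J F" and c: "c \<in> J" and x: "x \<in> J"
  shows "((\<lambda>u. LBINT y=ereal c..ereal u. F y) has_vector_derivative F x) (at x)"
proof -
  obtain a b where ab: "a < c" "c < b" "a < x" "x < b" "{a..b} \<subseteq> J"
    using Icc_in_open_interval[OF J c x] .
  have "((\<lambda>u. LBINT y=ereal c..ereal u. F y) has_vector_derivative F x) (at x within {a..b})"
    using ab F by (intro interval_integral_FTC2) (auto intro: continuous_on_subset)
  then show ?thesis using ab by (simp add: at_within_Icc_at)
qed

text \<open>Lets a continuous \<open>H\<close> replace the transform \<open>h\<close> under the
  integral of the integrating factor formula, after which the fundamental theorem applies.
  \<open>K\<close> is continuous only on the segment, so it is cut off there to be measurable; both
  orientations of the integral are covered.\<close>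

lemma interval_integral_mult_cong_AE:
  fixes K h H :: "real \<Rightarrow> complex"
  assumes K: "continuous_on {min u v..max u v} K"
    and [measurable]: "h \<in> borel_measurable borel" "H \<in> borel_measurable borel"
    and ae: "AE x in lborel. h x = H x"
  shows "(LBINT s=ereal u..ereal v. K s * h s) = (LBINT s=ereal u..ereal v. K s * H s)"
proof -
  have "set_lebesgue_integral lborel (einterval (ereal p) (ereal q)) (\<lambda>s. K s * h s)
      = set_lebesgue_integral lborel (einterval (ereal p) (ereal q)) (\<lambda>s. K s * H s)"
    if "{p..q} \<subseteq> {min u v..max u v}" for p q
  proof -
    have "continuous_on {p<..<q} K" using that by (intro continuous_on_subset[OF K]) auto
    then have [measurable]: "(\<lambda>s. indicator {p<..<q} s *\<^sub>R K s) \<in> borel_measurable borel"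
      by (intro borel_measurable_continuous_on_indicator) auto
    have "(\<lambda>s. (indicator {p<..<q} s *\<^sub>R K s) * f s) \<in> borel_measurable lborel"
      if [measurable]: "f \<in> borel_measurable borel" for f :: "real \<Rightarrow> complex"
      by measurable
    then have "(LINT s|lborel. (indicator {p<..<q} s *\<^sub>R K s) * h s) = (LINT s|lborel. (indicator {p<..<q} s *\<^sub>R K s) * H s)"
      using ae by (intro integral_cong_AE) auto
    then show ?thesis by (simp add: set_lebesgue_integral_def)
  qed
  from this[of u v] this[of v u] show ?thesis
    by (auto simp: interval_lebesgue_integral_def simp del: einterval_eq)
qed

section \<open>The integrating factor and uniqueness\<close>

lemma integrating_exponent_has_vector_derivative:
  fixes A B :: "real \<Rightarrow> complex"
  assumes J: "open J" "is_interval J" and A0: "\<And>w. w \<in> J \<Longrightarrow> A w \<noteq> 0" and w0: "w0 \<in> J"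
    and A: "continuous_on J A" and B: "continuous_on J B" and w: "w \<in> J"
  shows "((\<lambda>s. LBINT r=ereal w0..ereal s. B r / A r) has_vector_derivative B w / A w) (at w)"
  using A0 by (intro interval_integral_has_vector_derivative[OF J _ w0 w] continuous_intros A B) auto

text \<open>The formula contains \<open>h\<close>, but its derivative is expressed by
  \<open>H\<close>: exchanging them does not change the value of the integral, so differentiability
  holds at every point of \<open>J\<close> although \<open>h\<close> is controlled only almost
  everywhere.\<close>

lemma integrating_factor_solution_has_vector_derivative:
  fixes A B h H :: "real \<Rightarrow> complex"
  assumes J: "open J" "is_interval J" and A0: "\<And>w. w \<in> J \<Longrightarrow> A w \<noteq> 0" and w0: "w0 \<in> J"
    and A: "continuous_on J A" and B: "continuous_on J B" and H: "continuous_on UNIV H"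
    and h: "h \<in> borel_measurable borel" and ae: "AE w in lborel. h w = H w"
    and w: "w \<in> J"
  shows "(integrating_factor_solution A B h w0 c has_vector_derivative
          H w / A w - B w / A w * integrating_factor_solution A B h w0 c w) (at w)"
proof -
  let ?y = "integrating_factor_solution A B h w0 c"
  define P where "P = (\<lambda>s. LBINT r=ereal w0..ereal s. B r / A r)"
  have P: "(P has_vector_derivative B s / A s) (at s)" if "s \<in> J" for s
    unfolding P_def by (rule integrating_exponent_has_vector_derivative[OF J A0 w0 A B that])
  then have Pc: "continuous_on J P"
    by (auto intro!: continuous_at_imp_continuous_on has_vector_derivative_continuous)
  have Hm: "H \<in> borel_measurable borel" using H by (rule borel_measurable_continuous_onI)
  define Q where "Q = (\<lambda>u. LBINT s=ereal w0..ereal u. exp (P s) / A s * H s)"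
  have Q: "(Q has_vector_derivative exp (P w) / A w * H w) (at w)"
    unfolding Q_def using A0
    by (intro interval_integral_has_vector_derivative[OF J _ w0 w] continuous_intros A Pc continuous_on_subset[OF H]) auto
  have y: "?y u = exp (- P u) * (c + Q u)" if "u \<in> J" for u
  proof -
    have "{min w0 u..max w0 u} \<subseteq> J"
      using w0 that by (intro is_interval_imp_Icc_subset[OF J(2)]) (auto simp: min_def max_def)
    then have "continuous_on {min w0 u..max w0 u} (\<lambda>s. exp (P s) / A s)"
      using A0 by (intro continuous_intros continuous_on_subset[OF A] continuous_on_subset[OF Pc]) auto
    from interval_integral_mult_cong_AE[OF this h Hm ae] show ?thesis
      by (simp add: integrating_factor_solution_def Q_def P_def[symmetric] Let_def)
  qed
  have E: "((\<lambda>u. exp (- P u)) has_vector_derivative - (B w / A w) * exp (- P w)) (at w)"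
    using field_vector_diff_chain_at[OF has_vector_derivative_minus[OF P[OF w]] DERIV_exp]
    by (simp add: o_def)
  have "((\<lambda>u. exp (- P u) * (c + Q u)) has_vector_derivative
      exp (- P w) * (exp (P w) / A w * H w) + - (B w / A w) * exp (- P w) * (c + Q w)) (at w)"
    using has_vector_derivative_mult[OF E has_vector_derivative_add[OF has_vector_derivative_const Q], of c]
    by simp
  also have "exp (- P w) * (exp (P w) / A w * H w) + - (B w / A w) * exp (- P w) * (c + Q w)
      = H w / A w - B w / A w * ?y w"
    by (simp add: y[OF w] exp_minus field_simps)
  finally show "(?y has_vector_derivative H w / A w - B w / A w * ?y w) (at w)"
    by (rule has_vector_derivative_transform_within_open[OF _ J(1) w]) (simp add: y)
qed

lemma integrating_factor_solution_init: "integrating_factor_solution A B h w0 c w0 = c"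
  by (simp add: integrating_factor_solution_def)

lemma solves_linear_ode_on_integrating_factor:
  fixes A B h H :: "real \<Rightarrow> complex"
  assumes J: "open J" "is_interval J" and A0: "\<And>w. w \<in> J \<Longrightarrow> A w \<noteq> 0" and w0: "w0 \<in> J"
    and A: "continuous_on J A" and B: "continuous_on J B" and H: "continuous_on UNIV H"
    and h: "h \<in> borel_measurable borel" and ae: "AE w in lborel. h w = H w"
  shows "solves_linear_ode_on J A B h (integrating_factor_solution A B h w0 c)"
proof -
  note D = integrating_factor_solution_has_vector_derivative[OF J A0 w0 A B H h ae, of _ c]
  have "\<forall>w\<in>J. integrating_factor_solution A B h w0 c differentiable (at w)"
    using D by (blast intro: differentiableI_vector)
  moreover have "AE w in lborel. w \<in> J \<longrightarrow> A w * vector_derivative (integrating_factor_solution A B h w0 c) (at w)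
      + B w * integrating_factor_solution A B h w0 c w = h w"
    using ae by eventually_elim (auto simp: vector_derivative_at[OF D] A0 field_simps)
  ultimately show ?thesis by (simp add: solves_linear_ode_on_def)
qed

text \<open>The difference of two solutions, multiplied by \<open>exp P\<close>, is differentiable
  throughout \<open>J\<close> with derivative 0 almost everywhere. It is therefore constant, and it
  vanishes at \<open>w0\<close>.\<close>

lemma solves_linear_ode_on_unique:
  fixes A B h :: "real \<Rightarrow> complex"
  assumes J: "open J" "is_interval J" and A0: "\<And>w. w \<in> J \<Longrightarrow> A w \<noteq> 0" and w0: "w0 \<in> J"
    and A: "continuous_on J A" and B: "continuous_on J B"
    and y: "solves_linear_ode_on J A B h y" and z: "solves_linear_ode_on J A B h z"
    and eq: "z w0 = y w0" and w: "w \<in> J"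
  shows "z w = y w"
proof -
  define P where "P = (\<lambda>s. LBINT r=ereal w0..ereal s. B r / A r)"
  have P: "(P has_vector_derivative B s / A s) (at s)" if "s \<in> J" for s
    unfolding P_def by (rule integrating_exponent_has_vector_derivative[OF J A0 w0 A B that])
  define D where "D = (\<lambda>s. exp (P s) * (vector_derivative z (at s) - vector_derivative y (at s))
      + B s / A s * exp (P s) * (z s - y s))"
  have "((\<lambda>s. exp (P s) * (z s - y s)) has_vector_derivative D s) (at s)" if "s \<in> J" for s
  proof -
    have E: "((\<lambda>u. exp (P u)) has_vector_derivative B s / A s * exp (P s)) (at s)"
      using field_vector_diff_chain_at[OF P[OF that] DERIV_exp] by (simp add: o_def)
    have "(z has_vector_derivative vector_derivative z (at s)) (at s)"
      "(y has_vector_derivative vector_derivative y (at s)) (at s)"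
      using y z that by (auto simp: solves_linear_ode_on_def vector_derivative_works[symmetric])
    then show ?thesis
      unfolding D_def by (intro has_vector_derivative_mult E has_vector_derivative_diff)
  qed
  moreover have "AE s in lborel. s \<in> J \<longrightarrow> D s = 0"
    using y[unfolded solves_linear_ode_on_def, THEN conjunct2] z[unfolded solves_linear_ode_on_def, THEN conjunct2]
  proof eventually_elim
    case (elim s)
    show ?case
    proof
      assume s: "s \<in> J"
      with elim have "A s * (vector_derivative z (at s) - vector_derivative y (at s)) + B s * (z s - y s) = 0"
        by (simp add: algebra_simps)
      moreover have "D s = exp (P s) / A s * (A s * (vector_derivative z (at s) - vector_derivative y (at s)) + B s * (z s - y s))"
        using A0[OF s] by (simp add: D_def field_simps)
      ultimately show "D s = 0" by simp
    qed
  qed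
  ultimately have "exp (P w) * (z w - y w) = exp (P w0) * (z w0 - y w0)"
    by (rule AE_zero_derivative_imp_constant[OF J(2) _ _ w w0])
  then show ?thesis using eq by simp
qed

text \<open>The global solution \<open>y\<close> is a hypothesis because integrating factors yield
  solutions only between zeros of \<open>A\<close>, which in general do not fit together
  differentiably across a zero.\<close>

lemma solvable_linear_odeI:
  fixes A B h H :: "real \<Rightarrow> complex"
  assumes A: "continuous_on UNIV A" and B: "continuous_on UNIV B" and H: "continuous_on UNIV H"
    and h: "h \<in> borel_measurable borel" and ae: "AE w in lborel. h w = H w"
    and y: "solves_linear_ode_on UNIV A B h y"
  shows "solvable_linear_ode A B h"
  unfolding solvable_linear_ode_def
proof (intro conjI allI impI)
  show "\<exists>y. solves_linear_ode_on UNIV A B h y" using y by blast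
  fix J w0 c assume "open J \<and> is_interval J \<and> (\<forall>w\<in>J. A w \<noteq> 0) \<and> w0 \<in> J"
  then have J: "open J" "is_interval J" "\<And>w. w \<in> J \<Longrightarrow> A w \<noteq> 0" "w0 \<in> J" by auto
  have AB: "continuous_on J A" "continuous_on J B" using A B by (auto intro: continuous_on_subset)
  show sol: "solves_linear_ode_on J A B h (integrating_factor_solution A B h w0 c)"
    by (rule solves_linear_ode_on_integrating_factor[OF J AB H h ae])
  show "integrating_factor_solution A B h w0 c w0 = c" by (rule integrating_factor_solution_init)
  fix z assume "solves_linear_ode_on J A B h z \<and> z w0 = c"
  then show "\<forall>w\<in>J. z w = integrating_factor_solution A B h w0 c w"
    using solves_linear_ode_on_unique[OF J AB sol] by (simp add: integrating_factor_solution_init)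
next
  fix z assume "solves_linear_ode_on UNIV A B h z"
  then have "AE w in lborel. A w * vector_derivative z (at w) + B w * z w = h w"
    by (simp add: solves_linear_ode_on_def)
  then show "AE w in lborel. A w = 0 \<and> B w \<noteq> 0 \<longrightarrow> z w = h w / B w"
    by eventually_elim (auto simp: field_simps)
qed

subsection \<open>The transformed equation\<close>

lemma set_integrable_has_integral:
  fixes F :: "'a::euclidean_space \<Rightarrow> 'b::euclidean_space"
  assumes "set_integrable lborel S F"
  shows "(F has_integral (LINT x:S|lborel. F x)) S"
  using set_borel_integral_eq_integral[OF assms] by (simp add: has_integral_iff)

lemma has_integral_norm_le:
  fixes F :: "'a::euclidean_space \<Rightarrow> 'b::euclidean_space"
  assumes "(F has_integral i) S" and "(b has_integral j) S" and "\<And>x. x \<in> S \<Longrightarrow> norm (F x) \<le> b x"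
  shows "norm i \<le> j"
  using integral_norm_bound_integral[of F S b] assms by (auto simp: has_integral_iff)

locale linear_coefficient_ode =
  fixes a1 a2 a3 b1 b2 b3 :: complex and f f' f'' g :: "real \<Rightarrow> complex" and \<epsilon> :: real
  assumes g: "L2 g" and \<epsilon>: "\<epsilon> > 0"
    and decay: "((\<lambda>x. cmod (f x * of_real (\<bar>x\<bar> powr (2 + \<epsilon>)))) \<longlongrightarrow> 0) at_infinity"
    and f': "\<And>x. (f has_vector_derivative f' x) (at x)"
    and f'': "\<And>x. (f' has_vector_derivative f'' x) (at x)"
    and ode: "AE x in lborel. (a1 * of_real x + b1) * f'' x + (a2 * of_real x + b2) * f' x
             + (a3 * of_real x + b3) * f x = g x"
begin

definition p where "p x = a1 * of_real x + b1"
definition q where "q x = a2 * of_real x + b2"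
definition r where "r x = a3 * of_real x + b3"

lemma f_integrable: "integrable lborel f" "integrable lborel (\<lambda>x. of_real x * f x)"
  and f_decay: "((\<lambda>x. (1 + \<bar>x\<bar>) * cmod (f x)) \<longlongrightarrow> 0) at_infinity"
proof -
  have "continuous_on UNIV f"
    using f' by (intro continuous_at_imp_continuous_on ballI has_vector_derivative_continuous)
  from integrable_of_decay[OF this \<epsilon> decay]
  show "integrable lborel f" "integrable lborel (\<lambda>x. of_real x * f x)"
    "((\<lambda>x. (1 + \<bar>x\<bar>) * cmod (f x)) \<longlongrightarrow> 0) at_infinity" by auto
qed

text \<open>The boundary term \<open>p f' e - f (p e)' + q f e\<close> left by integrating by parts,
  with \<open>p' = a1\<close> inserted. The argument \<open>e'\<close> stands for the derivative of
  \<open>e\<close>.\<close>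

definition concomitant :: "(real \<Rightarrow> complex) \<Rightarrow> (real \<Rightarrow> complex) \<Rightarrow> real \<Rightarrow> complex" where
  "concomitant e e' x = p x * (f' x * e x - f x * e' x) + (q x - a1) * f x * e x"

text \<open>The formal adjoint \<open>(p e)'' - (q e)' + r e\<close>, expanded with
  \<open>p' = a1\<close>, \<open>p'' = 0\<close> and \<open>q' = a2\<close>.\<close>

definition adjoint_op :: "(real \<Rightarrow> complex) \<Rightarrow> (real \<Rightarrow> complex) \<Rightarrow> (real \<Rightarrow> complex) \<Rightarrow> real \<Rightarrow> complex" where
  "adjoint_op e e' e'' x = p x * e'' x + (2 * a1 - q x) * e' x + (r x - a2) * e x"

text \<open>The derivative of the concomitant is the operator applied to \<open>f\<close>, times
  \<open>e\<close>, minus \<open>f\<close> times the adjoint applied to \<open>e\<close>. The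
  equation then puts \<open>g\<close> in place of the operator off a null set. The gauge integral
  keeps \<open>f''\<close> free of integrability assumptions.\<close>

lemma Lagrange_identity:
  assumes e: "\<And>x. (e has_vector_derivative e' x) (at x)"
    and e': "\<And>x. (e' has_vector_derivative e'' x) (at x)" and "u \<le> v"
  shows "((\<lambda>x. g x * e x - f x * adjoint_op e e' e'' x) has_integral
          concomitant e e' v - concomitant e e' u) {u..v}"
proof -
  have lin: "((\<lambda>x. a * of_real x + b) has_vector_derivative a) (at x)" for a b :: complex and x :: real
  proof -
    have "((\<lambda>x. a * of_real x) has_vector_derivative a * of_real 1) (at x)"
      by (intro has_vector_derivative_mult_right has_vector_derivative_of_real DERIV_ident)
    from has_vector_derivative_add[OF this has_vector_derivative_const[of b]] show ?thesis by simp
  qed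
  have p: "(p has_vector_derivative a1) (at x)" and q: "(q has_vector_derivative a2) (at x)" for x
    using lin[of a1 b1] lin[of a2 b2] by (simp_all add: p_def[abs_def] q_def[abs_def])
  have "(concomitant e e' has_vector_derivative
      (p x * ((f' x * e' x + f'' x * e x) - (f x * e'' x + f' x * e' x)) + a1 * (f' x * e x - f x * e' x))
      + (((q x - a1) * f x) * e' x + ((q x - a1) * f' x + (a2 - 0) * f x) * e x)) (at x)" for x
    unfolding concomitant_def[abs_def]
    by (intro has_vector_derivative_add has_vector_derivative_mult has_vector_derivative_diff p q f' f'' e e'
        has_vector_derivative_const)
  then have "((\<lambda>x. (p x * ((f' x * e' x + f'' x * e x) - (f x * e'' x + f' x * e' x)) + a1 * (f' x * e x - f x * e' x))
      + (((q x - a1) * f x) * e' x + ((q x - a1) * f' x + (a2 - 0) * f x) * e x)) has_integral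
          concomitant e e' v - concomitant e e' u) {u..v}"
    using \<open>u \<le> v\<close> by (intro fundamental_theorem_of_calculus) (auto intro: has_vector_derivative_at_within)
  moreover have "AE x in lborel. x \<in> {u..v} \<longrightarrow>
      (p x * ((f' x * e' x + f'' x * e x) - (f x * e'' x + f' x * e' x)) + a1 * (f' x * e x - f x * e' x))
      + (((q x - a1) * f x) * e' x + ((q x - a1) * f' x + (a2 - 0) * f x) * e x)
      = g x * e x - f x * adjoint_op e e' e'' x"
    using ode
  proof eventually_elim
    case (elim x)
    then have "g x = p x * f'' x + q x * f' x + r x * f x" by (simp add: p_def q_def r_def)
    then show ?case by (simp add: adjoint_op_def algebra_simps)
  qed
  ultimately show ?thesis by (rule has_integral_cong_AE[rotated])
qed

section \<open>Decay of the boundary terms\<close>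

definition coeff_bound where
  "coeff_bound = cmod a1 + cmod a2 + cmod a3 + cmod b1 + cmod b2 + cmod b3"

lemma coeff_bound:
  "cmod (p x) \<le> coeff_bound * (1 + \<bar>x\<bar>)" "cmod (q x) \<le> coeff_bound * (1 + \<bar>x\<bar>)"
  "cmod (r x) \<le> coeff_bound * (1 + \<bar>x\<bar>)"
  "cmod a1 \<le> coeff_bound * (1 + \<bar>x\<bar>)" "cmod a2 \<le> coeff_bound * (1 + \<bar>x\<bar>)" "0 \<le> coeff_bound"
proof -
  have *: "cmod (a * of_real x + b) \<le> coeff_bound * (1 + \<bar>x\<bar>)"
    if "cmod a \<le> coeff_bound" "cmod a + cmod b \<le> coeff_bound" for a b
  proof -
    have "cmod (a * of_real x + b) \<le> cmod a * \<bar>x\<bar> + cmod b"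
      by (rule order_trans[OF norm_triangle_ineq]) (simp add: norm_mult)
    also have "\<dots> \<le> coeff_bound * \<bar>x\<bar> + coeff_bound"
    proof (intro add_mono mult_right_mono that)
      show "cmod b \<le> coeff_bound" using that(2) norm_ge_zero[of a] by linarith
    qed simp
    finally show ?thesis by (simp add: algebra_simps)
  qed
  show "cmod (p x) \<le> coeff_bound * (1 + \<bar>x\<bar>)" "cmod (q x) \<le> coeff_bound * (1 + \<bar>x\<bar>)"
    "cmod (r x) \<le> coeff_bound * (1 + \<bar>x\<bar>)"
    unfolding p_def q_def r_def by (rule *; simp add: coeff_bound_def)+
  show 0: "0 \<le> coeff_bound" by (simp add: coeff_bound_def)
  have "coeff_bound * 1 \<le> coeff_bound * (1 + \<bar>x\<bar>)" using 0 by (intro mult_left_mono) auto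
  moreover have "cmod a1 \<le> coeff_bound" "cmod a2 \<le> coeff_bound" by (simp_all add: coeff_bound_def)
  ultimately show "cmod a1 \<le> coeff_bound * (1 + \<bar>x\<bar>)" "cmod a2 \<le> coeff_bound * (1 + \<bar>x\<bar>)" by auto
qed

lemma coeff_mult_bound:
  assumes "cmod c \<le> coeff_bound * (1 + \<bar>x\<bar>)" and "(1 + \<bar>x\<bar>) * cmod (f x) \<le> \<delta>"
  shows "cmod (c * f x) \<le> coeff_bound * \<delta>"
proof -
  have "cmod (c * f x) \<le> (coeff_bound * (1 + \<bar>x\<bar>)) * cmod (f x)"
    unfolding norm_mult using assms(1) by (rule mult_right_mono) simp
  also have "\<dots> \<le> coeff_bound * \<delta>"
    unfolding mult.assoc using assms(2) coeff_bound(6) by (rule mult_left_mono)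
  finally show ?thesis .
qed

text \<open>Testing against the affine function that equals 1 at \<open>x\<close> and vanishes at distance 1
  from \<open>x\<close> (away from the origin) expresses \<open>p x * f' x\<close> through integrals over a unit
  interval and values of \<open>f\<close>; no hypothesis on the decay of \<open>f'\<close> is available.\<close>

lemma p_f'_tendsto_0: "((\<lambda>x. p x * f' x) \<longlongrightarrow> 0) at_infinity"
proof (rule tendstoI)
  fix \<eta> :: real assume "\<eta> > 0"
  define N where "N = coeff_bound"
  have N: "N \<ge> 0" using coeff_bound(6) by (simp add: N_def)
  \<comment> \<open>The error adds up to \<open>(2 + 9 * N) * \<delta>\<close>:
    \<open>2 * \<delta>\<close> from \<open>g\<close>, \<open>5 * N * \<delta>\<close> from the
    adjoint (where \<open>a1\<close> counts twice), and \<open>4 * N * \<delta>\<close> from values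
    of \<open>f\<close> at the two endpoints. The 3 in the denominator makes the final inequality
    strict.\<close>
  define \<delta> where "\<delta> = \<eta> / (3 + 9 * N)"
  have \<delta>: "\<delta> > 0" "(2 + 9 * N) * \<delta> < \<eta>"
    using N \<open>\<eta> > 0\<close> by (simp_all add: \<delta>_def field_simps)
  have g2: "integrable lborel (\<lambda>t. (cmod (g t))\<^sup>2)" and gm[measurable]: "g \<in> borel_measurable borel"
    using g by (simp_all add: L2_def)
  have "eventually (\<lambda>R. (LINT t:- {-R..R}|lborel. (cmod (g t))\<^sup>2) < \<delta>\<^sup>2) at_top"
    using \<delta>(1) by (intro order_tendstoD(2)[OF tendsto_tail_integral_at_top[OF g2]]) simp
  then obtain R where R: "(LINT t:- {-R..R}|lborel. (cmod (g t))\<^sup>2) < \<delta>\<^sup>2"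
    by (auto simp: eventually_at_top_linorder)
  have "eventually (\<lambda>x. (1 + \<bar>x\<bar>) * cmod (f x) < \<delta>) at_infinity"
    using f_decay \<delta>(1) by (auto dest: order_tendstoD(2))
  then obtain T where T: "\<And>x. \<bar>x\<bar> \<ge> T \<Longrightarrow> (1 + \<bar>x\<bar>) * cmod (f x) \<le> \<delta>"
    by (auto simp: eventually_at_infinity intro: less_imp_le)
  have "cmod (p x * f' x) < \<eta>" if x: "\<bar>x\<bar> \<ge> max T (\<bar>R\<bar> + 1)" for x
  proof -
    \<comment> \<open>Stepping away from the origin keeps the whole unit interval in the region
      where \<open>f\<close> and the tail of \<open>g\<close> are small.\<close>
    define s :: real where "s = (if x \<ge> 0 then 1 else - 1)"
    define u v where "u = min x (x + s)" and "v = max x (x + s)"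
    have uv: "u \<le> v" "v - u = 1" by (auto simp: u_def v_def s_def)
    have far: "\<bar>t\<bar> \<ge> T" "t \<notin> {-R..R}" "\<bar>t - x\<bar> \<le> 1" "0 \<le> s * (t - x)" if "t \<in> {u..v}" for t
      using x that by (auto simp: u_def v_def s_def abs_if min_def max_def split: if_splits)
    define e :: "real \<Rightarrow> complex" where "e = (\<lambda>t. of_real (1 - s * (t - x)))"
    define e' :: "real \<Rightarrow> complex" where "e' = (\<lambda>t. - of_real s)"
    have e: "(e has_vector_derivative e' t) (at t)" "(e' has_vector_derivative 0) (at t)" for t
    proof -
      have "((\<lambda>t. 1 - s * (t - x)) has_real_derivative - s) (at t)"
        by (auto intro!: derivative_eq_intros)
      then show "(e has_vector_derivative e' t) (at t)"
        unfolding e_def e'_def of_real_minus[symmetric] by (rule has_vector_derivative_of_real)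
      show "(e' has_vector_derivative 0) (at t)" unfolding e'_def by (rule has_vector_derivative_const)
    qed
    have s1: "\<bar>s\<bar> = 1" "s * s = 1" by (auto simp: s_def)
    have ne: "cmod (e t) \<le> 1" if "t \<in> {u..v}" for t
      using far(3,4)[OF that] s1 unfolding e_def norm_of_real by (auto simp: s_def abs_if split: if_splits)
    let ?I = "\<lambda>t. g t * e t - f t * adjoint_op e e' (\<lambda>_. 0) t"
    have I: "(?I has_integral concomitant e e' v - concomitant e e' u) {u..v}"
      by (rule Lagrange_identity[OF e uv(1)])
    have g2u: "set_integrable lborel {u..v} (\<lambda>t. (cmod (g t))\<^sup>2)"
      unfolding set_integrable_def using g2 by (intro integrable_mult_indicator) auto
    let ?b = "\<lambda>t. (1 + 5 * N) * \<delta> + (cmod (g t))\<^sup>2 / \<delta>"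
    have b: "(?b has_integral ((1 + 5 * N) * \<delta> + (LINT t:{u..v}|lborel. (cmod (g t))\<^sup>2) / \<delta>)) {u..v}"
    proof -
      have "((\<lambda>t. (cmod (g t))\<^sup>2) has_integral (LINT t:{u..v}|lborel. (cmod (g t))\<^sup>2)) {u..v}"
        by (rule set_integrable_has_integral[OF g2u])
      from has_integral_add[OF has_integral_const_real[of "(1 + 5 * N) * \<delta>" u v] has_integral_divide[OF this, of \<delta>]]
      show ?thesis using uv by simp
    qed
    have "cmod (concomitant e e' v - concomitant e e' u) \<le> (1 + 5 * N) * \<delta> + (LINT t:{u..v}|lborel. (cmod (g t))\<^sup>2) / \<delta>"
    proof (rule has_integral_norm_le[OF I b])
      fix t assume t: "t \<in> {u..v}"
      note ft = T[OF far(1)[OF t]]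
      note c = coeff_mult_bound[OF coeff_bound(1) ft] coeff_mult_bound[OF coeff_bound(2) ft]
        coeff_mult_bound[OF coeff_bound(3) ft] coeff_mult_bound[OF coeff_bound(4) ft] coeff_mult_bound[OF coeff_bound(5) ft]
      have "f t * adjoint_op e e' (\<lambda>_. 0) t
        = of_real s * (q t * f t) - of_real s * (a1 * f t) - of_real s * (a1 * f t) + e t * (r t * f t) - e t * (a2 * f t)"
        by (simp add: adjoint_op_def e'_def algebra_simps)
      also have "cmod \<dots> \<le> cmod (q t * f t) + cmod (a1 * f t) + cmod (a1 * f t) + cmod (r t * f t) + cmod (a2 * f t)"
      proof -
        have "cmod (e t * z) \<le> cmod z" for z
          unfolding norm_mult using mult_right_mono[OF ne[OF t], of "cmod z"] by simp
        moreover have "cmod (of_real s * z) = cmod z" for z by (simp add: norm_mult s1)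
        ultimately show ?thesis
          by (intro norm_triangle_le norm_triangle_le_diff add_mono) auto
      qed
      also have "\<dots> \<le> 5 * (N * \<delta>)" using c unfolding N_def by linarith
      finally have 1: "cmod (f t * adjoint_op e e' (\<lambda>_. 0) t) \<le> 5 * (N * \<delta>)" .
      \<comment> \<open>A pointwise stand-in for Cauchy-Schwarz. Since the tail of the integral of
        \<open>(cmod (g t))\<^sup>2\<close> is below \<open>\<delta>\<^sup>2\<close>, the right-hand
        side integrates to at most \<open>2 * \<delta>\<close> over the unit interval.\<close>
      have "cmod (g t) \<le> \<delta> + (cmod (g t))\<^sup>2 / \<delta>"
      proof (cases "cmod (g t) \<le> \<delta>")
        case True
        moreover have "0 \<le> (cmod (g t))\<^sup>2 / \<delta>" using \<delta>(1) by simp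
        ultimately show ?thesis by linarith
      next
        case False
        then have "cmod (g t) * \<delta> \<le> (cmod (g t))\<^sup>2" by (simp add: power2_eq_square mult_left_mono)
        then have "cmod (g t) \<le> (cmod (g t))\<^sup>2 / \<delta>" using \<delta>(1) by (simp add: field_simps)
        then show ?thesis using \<delta>(1) by linarith
      qed
      moreover have "cmod (g t * e t) \<le> cmod (g t)"
        unfolding norm_mult using mult_left_mono[OF ne[OF t], of "cmod (g t)"] by simp
      ultimately have "cmod (?I t) \<le> (\<delta> + (cmod (g t))\<^sup>2 / \<delta>) + 5 * (N * \<delta>)"
        using 1 by (intro norm_triangle_le_diff) linarith
      then show "norm (?I t) \<le> ?b t" by (simp add: algebra_simps)
    qed
    moreover have "(LINT t:{u..v}|lborel. (cmod (g t))\<^sup>2) \<le> (LINT t:- {-R..R}|lborel. (cmod (g t))\<^sup>2)"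
      unfolding set_lebesgue_integral_def using far(2)
      by (intro integral_mono integrable_mult_indicator g2) (auto simp: indicator_def)
    then have "(LINT t:{u..v}|lborel. (cmod (g t))\<^sup>2) / \<delta> \<le> \<delta>"
      using R \<delta>(1) by (simp add: field_simps power2_eq_square)
    moreover have "cmod (concomitant e e' x - concomitant e e' (x + s)) = cmod (concomitant e e' v - concomitant e e' u)"
      by (auto simp: u_def v_def min_def max_def norm_minus_commute)
    ultimately have le: "cmod (concomitant e e' x - concomitant e e' (x + s)) \<le> (2 + 5 * N) * \<delta>"
      by (simp add: algebra_simps)
    have "x \<in> {u..v}" "x + s \<in> {u..v}" by (auto simp: u_def v_def)
    note fx = T[OF far(1)[OF this(1)]] T[OF far(1)[OF this(2)]]
    note c = coeff_mult_bound[OF coeff_bound(1) fx(1)] coeff_mult_bound[OF coeff_bound(2) fx(1)]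
        coeff_mult_bound[OF coeff_bound(4) fx(1)] coeff_mult_bound[OF coeff_bound(1) fx(2)]
    \<comment> \<open>The zero of \<open>e\<close> removes \<open>f' (x + s)\<close> from the
      concomitant at the far endpoint, so \<open>f' x\<close> is the only derivative left.\<close>
    have ex: "e x = 1" "e (x + s) = 0" by (auto simp: e_def s_def)
    have "p x * f' x = (concomitant e e' x - concomitant e e' (x + s))
        + of_real s * (p (x + s) * f (x + s)) - of_real s * (p x * f x) - q x * f x + a1 * f x"
      by (simp only: concomitant_def ex e'_def) (simp add: algebra_simps)
    also have "cmod \<dots> \<le> cmod (concomitant e e' x - concomitant e e' (x + s))
        + cmod (p (x + s) * f (x + s)) + cmod (p x * f x) + cmod (q x * f x) + cmod (a1 * f x)"
    proof -
      have tri: "cmod (d + y1 - y2 - y3 + y4) \<le> cmod d + cmod y1 + cmod y2 + cmod y3 + cmod y4"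
        for d y1 y2 y3 y4 :: complex
        by (intro norm_triangle_le norm_triangle_le_diff add_mono) auto
      have "cmod (of_real s * z) = cmod z" for z by (simp add: norm_mult s1)
      then show ?thesis by (intro order_trans[OF tri]) (simp only: order_refl)
    qed
    also have "\<dots> \<le> (2 + 5 * N) * \<delta> + N * \<delta> + N * \<delta> + N * \<delta> + N * \<delta>"
      using le c unfolding N_def by linarith
    also have "\<dots> < \<eta>" using \<delta>(2) by (simp add: algebra_simps)
    finally show ?thesis .
  qed
  then show "eventually (\<lambda>x. dist (p x * f' x) 0 < \<eta>) at_infinity"
    unfolding eventually_at_infinity by (intro exI[of _ "max T (\<bar>R\<bar> + 1)"]) auto
qed

text \<open>Apply the adjoint to the kernel and sort by powers of \<open>t\<close>: \<open>B\<close>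
  is the constant coefficient, and \<open>A\<close> is \<open>\<i>\<close> times the coefficient of
  \<open>t\<close>, because the transform of \<open>t * f t\<close> is \<open>\<i>\<close> times the
  derivative of the transform of \<open>f\<close>. Formally, with \<open>F\<close> the transform of
  \<open>f\<close>, that of \<open>t * f' t\<close> is \<open>- w * F' - F\<close>, so
  \<open>a2\<close> carries a minus sign in both coefficients; the informal statement displays a
  plus.\<close>

definition A where "A w = - \<i> * a1 * of_real w ^ 2 - a2 * of_real w + \<i> * a3"
definition B where "B w = - b1 * of_real w ^ 2 - 2 * \<i> * a1 * of_real w + \<i> * b2 * of_real w - a2 + b3"
text \<open>The continuous representative of \<open>fourier g\<close>. The derivative of the
  transform of \<open>f\<close> is written as a Fourier integral, so that continuity is
  immediate.\<close>

definition H where "H w = A w * (- \<i> * fourier_integral (\<lambda>t. of_real t * f t) w) + B w * fourier_integral f w"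

text \<open>The kernel has modulus 1 and its derivative modulus \<open>\<bar>w\<bar>\<close>. Apart
  from \<open>p x * f' x\<close>, each term is a coefficient of linear growth times
  \<open>f x\<close>: the factor \<open>\<bar>w\<bar>\<close> belongs to \<open>p\<close>, the 2 to
  \<open>q\<close> and \<open>a1\<close>.\<close>

lemma concomitant_kernel_tendsto_0:
  "((\<lambda>x. concomitant (fourier_kernel w) (\<lambda>t. - \<i> * of_real w * fourier_kernel w t) x) \<longlongrightarrow> 0) at_infinity"
proof (rule Lim_null_comparison)
  show "eventually (\<lambda>x. cmod (concomitant (fourier_kernel w) (\<lambda>t. - \<i> * of_real w * fourier_kernel w t) x)
      \<le> cmod (p x * f' x) + (\<bar>w\<bar> + 2) * (coeff_bound * ((1 + \<bar>x\<bar>) * cmod (f x)))) at_infinity"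
  proof (intro always_eventually allI)
    fix x
    let ?K = "coeff_bound * ((1 + \<bar>x\<bar>) * cmod (f x))"
    have c: "cmod (p x * f x) \<le> ?K" "cmod (q x * f x) \<le> ?K" "cmod (a1 * f x) \<le> ?K"
      by (rule coeff_mult_bound[OF _ order_refl], rule coeff_bound)+
    have "concomitant (fourier_kernel w) (\<lambda>t. - \<i> * of_real w * fourier_kernel w t) x
        = fourier_kernel w x * (p x * f' x + \<i> * of_real w * (p x * f x) + q x * f x - a1 * f x)"
      by (simp add: concomitant_def algebra_simps)
    then have "cmod (concomitant (fourier_kernel w) (\<lambda>t. - \<i> * of_real w * fourier_kernel w t) x)
        = cmod (p x * f' x + \<i> * of_real w * (p x * f x) + q x * f x - a1 * f x)"
      by (simp only: norm_mult norm_fourier_kernel mult_1)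
    also have "\<dots> \<le> cmod (p x * f' x) + \<bar>w\<bar> * cmod (p x * f x) + cmod (q x * f x) + cmod (a1 * f x)"
      by (intro norm_triangle_le norm_triangle_le_diff add_mono) (auto simp: norm_mult)
    also have "\<dots> \<le> cmod (p x * f' x) + \<bar>w\<bar> * ?K + ?K + ?K"
      using c by (intro add_mono mult_left_mono) auto
    finally show "cmod (concomitant (fourier_kernel w) (\<lambda>t. - \<i> * of_real w * fourier_kernel w t) x)
      \<le> cmod (p x * f' x) + (\<bar>w\<bar> + 2) * ?K" by (simp add: algebra_simps)
  qed
  have "((\<lambda>x. cmod (p x * f' x) + (\<bar>w\<bar> + 2) * (coeff_bound * ((1 + \<bar>x\<bar>) * cmod (f x)))) \<longlongrightarrow>
      0 + (\<bar>w\<bar> + 2) * (coeff_bound * 0)) at_infinity"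
    by (intro tendsto_add tendsto_norm_zero p_f'_tendsto_0 tendsto_mult_left f_decay)
  then show "((\<lambda>x. cmod (p x * f' x) + (\<bar>w\<bar> + 2) * (coeff_bound * ((1 + \<bar>x\<bar>) * cmod (f x)))) \<longlongrightarrow> 0) at_infinity"
    by simp
qed

lemma truncated_transform_tendsto:
  "((\<lambda>R. fourier_integral (\<lambda>t. indicator {-R..R} t *\<^sub>R g t) w) \<longlongrightarrow> H w) at_top"
proof -
  let ?e = "fourier_kernel w"
  let ?e' = "\<lambda>t. - \<i> * of_real w * ?e t"
  let ?e'' = "\<lambda>t. - \<i> * of_real w * ?e' t"
  let ?L = "\<lambda>t. f t * adjoint_op ?e ?e' ?e'' t"
  define \<alpha> where "\<alpha> = - b1 * of_real w ^ 2 - 2 * \<i> * a1 * of_real w + \<i> * b2 * of_real w - a2 + b3"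
  define \<beta> where "\<beta> = - a1 * of_real w ^ 2 + \<i> * a2 * of_real w + a3"
  have L: "?L = (\<lambda>t. \<alpha> * (f t * ?e t) + \<beta> * ((of_real t * f t) * ?e t))"
    by (rule ext) (simp add: adjoint_op_def p_def q_def r_def \<alpha>_def \<beta>_def power2_eq_square algebra_simps)
  note i = f_integrable[THEN integrable_mult_fourier_kernel, of w]
  have Li: "integrable lborel ?L" unfolding L using i by auto
  have "integral\<^sup>L lborel ?L = \<alpha> * fourier_integral f w + \<beta> * fourier_integral (\<lambda>t. of_real t * f t) w"
    unfolding L fourier_integral_def using i by simp
  also have "\<dots> = H w"
    by (simp add: H_def A_def B_def \<alpha>_def \<beta>_def algebra_simps)
  finally have LH: "integral\<^sup>L lborel ?L = H w" .
  have eq: "fourier_integral (\<lambda>t. indicator {-R..R} t *\<^sub>R g t) w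
      = concomitant ?e ?e' R - concomitant ?e ?e' (-R) + (LINT t:{-R..R}|lborel. ?L t)" if "0 \<le> R" for R
  proof -
    \<comment> \<open>Both summands are Lebesgue integrable over the bounded interval, so the gauge
      integral in Lagrange's identity splits into the truncated transform of \<open>g\<close> and a
      truncation of an integrable function.\<close>
    have "set_integrable lborel {-R..R} (\<lambda>t. g t * ?e t)"
      using integrable_mult_fourier_kernel[OF L2_integrable_Icc[OF g], of "-R" R w]
      by (simp add: set_integrable_def)
    moreover have "set_integrable lborel {-R..R} ?L"
      unfolding set_integrable_def using Li by (intro integrable_mult_indicator) auto
    ultimately have "((\<lambda>t. g t * ?e t - ?L t) has_integral
        (LINT t:{-R..R}|lborel. g t * ?e t) - (LINT t:{-R..R}|lborel. ?L t)) {-R..R}"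
      by (intro has_integral_diff set_integrable_has_integral)
    moreover have "((\<lambda>t. g t * ?e t - ?L t) has_integral concomitant ?e ?e' R - concomitant ?e ?e' (-R)) {-R..R}"
      using that
      by (intro Lagrange_identity has_vector_derivative_mult_right fourier_kernel_has_vector_derivative(2)) auto
    ultimately have "(LINT t:{-R..R}|lborel. g t * ?e t) - (LINT t:{-R..R}|lborel. ?L t)
        = concomitant ?e ?e' R - concomitant ?e ?e' (-R)"
      by (rule has_integral_unique)
    then show ?thesis
      by (simp add: fourier_integral_def set_lebesgue_integral_def algebra_simps)
  qed
  have c1: "((\<lambda>R. concomitant ?e ?e' R) \<longlongrightarrow> 0) at_top"
    using concomitant_kernel_tendsto_0 by (rule tendsto_mono[OF at_top_le_at_infinity])
  have c2: "((\<lambda>R. concomitant ?e ?e' (-R)) \<longlongrightarrow> 0) at_top"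
    by (rule filterlim_compose[OF concomitant_kernel_tendsto_0])
      (rule filterlim_mono[OF filterlim_uminus_at_bot_at_top at_bot_le_at_infinity order_refl])
  have "((\<lambda>R. concomitant ?e ?e' R - concomitant ?e ?e' (-R) + (LINT t:{-R..R}|lborel. ?L t)) \<longlongrightarrow> 0 - 0 + H w) at_top"
    unfolding LH[symmetric] by (intro tendsto_add tendsto_diff c1 c2 tendsto_integral_Icc_at_top Li)
  then have "((\<lambda>R. concomitant ?e ?e' R - concomitant ?e ?e' (-R) + (LINT t:{-R..R}|lborel. ?L t)) \<longlongrightarrow> H w) at_top"
    by simp
  then show ?thesis
    by (rule Lim_transform_eventually) (rule eventually_mono[OF eventually_ge_at_top[of 0]], simp only: eq)
qed

lemma AB_continuous: "continuous_on UNIV A" "continuous_on UNIV B"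
  unfolding A_def B_def by (intro continuous_intros)+

lemma H_continuous: "continuous_on UNIV H"
  unfolding H_def
  by (intro continuous_intros AB_continuous fourier_integral_continuous f_integrable)

lemma fourier_f_has_vector_derivative:
  "(fourier f has_vector_derivative - \<i> * fourier_integral (\<lambda>t. of_real t * f t) w) (at w)"
  unfolding fourier_eq_fourier_integral[OF f_integrable(1)]
  by (rule fourier_integral_has_vector_derivative[OF f_integrable])

lemma fourier_g: "fourier g \<in> borel_measurable borel" "AE w in lborel. fourier g w = H w"
  by (rule fourier_of_pointwise[OF g borel_measurable_continuous_onI[OF H_continuous] truncated_transform_tendsto])+

lemma solves_transformed_ode: "solves_linear_ode_on UNIV A B (fourier g) (fourier f)"
proof -
  note ff = fourier_eq_fourier_integral[OF f_integrable(1)]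
  have "AE w in lborel. A w * vector_derivative (fourier f) (at w) + B w * fourier f w = fourier g w"
    using fourier_g(2) by eventually_elim
      (simp add: vector_derivative_at[OF fourier_f_has_vector_derivative[unfolded ff]] H_def ff)
  moreover have "\<forall>w. fourier f differentiable (at w)"
    using fourier_f_has_vector_derivative by (blast intro: differentiableI_vector)
  ultimately show ?thesis by (simp add: solves_linear_ode_on_def)
qed

lemma solvable_transformed_ode: "solvable_linear_ode A B (fourier g)"
  by (rule solvable_linear_odeI[OF AB_continuous H_continuous fourier_g solves_transformed_ode])

end

theorem theorem6:
  fixes a1 a2 a3 b1 b2 b3 :: complex
    and f f' f'' g :: "real \<Rightarrow> complex"
    and \<epsilon> :: real
  assumes "L2 f" and "L2 g"
    and "\<epsilon> > 0"
    and "((\<lambda>x. cmod (f x * of_real (\<bar>x\<bar> powr (2 + \<epsilon>)))) \<longlongrightarrow> 0) at_infinity"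
    and "\<And>x. (f has_vector_derivative f' x) (at x)"
    and "\<And>x. (f' has_vector_derivative f'' x) (at x)"
    and "AE x in lborel.
           (a1 * of_real x + b1) * f'' x + (a2 * of_real x + b2) * f' x
             + (a3 * of_real x + b3) * f x = g x"
  shows "(\<forall>\<gamma>. fourier f differentiable (at \<gamma>)) \<and>
    (AE \<gamma> in lborel.
       (- \<i> * a1 * of_real \<gamma> ^ 2 - a2 * of_real \<gamma> + \<i> * a3)
           * vector_derivative (fourier f) (at \<gamma>)
         + (- b1 * of_real \<gamma> ^ 2 - 2 * \<i> * a1 * of_real \<gamma> + \<i> * b2 * of_real \<gamma> - a2 + b3)
           * fourier f \<gamma>
       = fourier g \<gamma>) \<and>
    solvable_linear_ode
      (\<lambda>\<gamma>. - \<i> * a1 * of_real \<gamma> ^ 2 - a2 * of_real \<gamma> + \<i> * a3)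
      (\<lambda>\<gamma>. - b1 * of_real \<gamma> ^ 2 - 2 * \<i> * a1 * of_real \<gamma> + \<i> * b2 * of_real \<gamma> - a2 + b3)
      (fourier g)"
proof -
  interpret linear_coefficient_ode a1 a2 a3 b1 b2 b3 f f' f'' g \<epsilon>
    using assms by unfold_locales
  show ?thesis
    using solves_transformed_ode solvable_transformed_ode
    by (simp add: solves_linear_ode_on_def A_def[abs_def] B_def[abs_def])
qed

end
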